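(* For $\beta>1$, let $(\Sigma_\beta,\sigma_\beta)$ denote the $\beta$-shift. Then the completely-irregular set $$CI(\sigma_\beta)=\bigcap_{\phi\in\hat{C}^0_{\sigma_\beta}(\Sigma_\beta)}I(\phi,\sigma_\beta)$$ has full topological entropy, full topological pressure, full BS-dimension and full Hausdorff dimension; that is, $h_{top}(\sigma_\beta,CI(\sigma_\beta))=h_{top}(\sigma_\beta,\Sigma_\beta)$, $P(CI(\sigma_\beta),\varphi,\sigma_\beta)=P(\Sigma_\beta,\varphi,\sigma_\beta)$ for every $\varphi\in C^0(\Sigma_\beta)$, $BS(CI(\sigma_\beta),\varphi,\sigma_\beta)=BS(\Sigma_\beta,\varphi,\sigma_\beta)$ for every strictly positive $\varphi\in C^0(\Sigma_\beta)$, and $\dim_H(CI(\sigma_\beta))=\dim_H(\Sigma_\beta)$.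
   Context: $\beta$-shift: for non-integer $\beta>1$ write $1=\sum_{n\ge1}a_n\beta^{-n}$ with $a_1=[\beta]$ and $a_n=[\beta^n-\sum_{i=1}^{n-1}a_i\beta^{n-i}]$ ($[\cdot]$ = integer part); let $k=[\beta]+1$, $Y=\{0,\dots,k-1\}$, $a=(a_n)_{n\ge1}\in\prod_{n\ge1}Y$, let $\sigma$ be the one-sided shift on $\prod_{n\ge1}Y$ and $\le$ the lexicographic order. Then $\Sigma_\beta=\{x\in\prod_{n\ge1}Y:\sigma^n(x)\le a\ \text{for all } n\ge0\}$, a closed shift-invariant set, and $\sigma_\beta=\sigma|_{\Sigma_\beta}$. For integer $\beta$, $\Sigma_\beta$ is the full one-sided shift on $\beta$ symbols. $\Sigma_\beta$ carries the metric $d(x,y)=\beta^{-n}$, where $n\ge0$ is least with $x_{n+1}\ne y_{n+1}$ (and $d(x,x)=0$); Hausdorff dimension is with respect to $d$. For a continuous map $f$ of a compact metric space $X$: $I(\phi,f)$ is the set of $x$ for which $\lim_{n\to\infty}\frac1n\sum_{i=0}^{n-1}\phi(f^i(x))$ does not exist, and $\hat{C}^0_f(X)=\{\phi\in C^0(X):I(\phi,f)\ne\emptyset\}$. Topological pressure, entropy, BS-dimension of $E\subseteq X$: let $B_m(x,\epsilon)=\{y\in X:d(f^jx,f^jy)\le\epsilon,\ 0\le j\le m-1\}$ and let $\mathfrak{F}_n(E,\epsilon)$ be the collection of all finite or countable covers of $E$ by sets $B_m(x,\epsilon)$ with $m\ge n$. For $\varphi\in C^0(X)$, $$C(E;t,\varphi,n,\epsilon,f)=\inf\Big\{\sum_{B_m(x,\epsilon)\in\mathcal{C}}2^{-tm+\sup_{y\in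 B_m(x,\epsilon)}\sum_{i=0}^{m-1}\varphi(f^i(y))}:\mathcal{C}\in\mathfrak{F}_n(E,\epsilon)\Big\},$$ $C(E;t,\varphi,\epsilon,f)=\lim_{n\to\infty}C(E;t,\varphi,n,\epsilon,f)$, $P(E,\varphi,\epsilon,f)=\inf\{t:C(E;t,\varphi,\epsilon,f)=0\}$, $P(E,\varphi,f)=\lim_{\epsilon\to0}P(E,\varphi,\epsilon,f)$, and $h_{top}(f,E)=P(E,0,f)$. For $\varphi>0$, $$N(E;t,\varphi,n,\epsilon,f)=\inf\Big\{\sum_{B_m(x,\epsilon)\in\mathcal{C}}2^{-t\sup_{y\in B_m(x,\epsilon)}\sum_{i=0}^{m-1}\varphi(f^i(y))}:\mathcal{C}\in\mathfrak{F}_n(E,\epsilon)\Big\},$$ $N(E;t,\varphi,\epsilon,f)=\lim_{n\to\infty}N(E;t,\varphi,n,\epsilon,f)$, $BS(E,\varphi,\epsilon,f)=\inf\{t:N(E;t,\varphi,\epsilon,f)=0\}$, $BS(E,\varphi,f)=\lim_{\epsilon\to0}BS(E,\varphi,\epsilon,f)$. *)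

theory Defs
  imports "HOL-Analysis.Analysis" "HOL-Library.Fun_Lexorder"
begin

section \<open>Irregular sets\<close>

text \<open>
  A dynamical system is given by a carrier \<open>X\<close>, a metric \<open>d\<close> on \<open>X\<close> and a map \<open>f\<close>, which is only
  used on \<open>X\<close>.  A continuous function on \<open>X\<close> is represented by any total function that is continuous
  on \<open>X\<close> in the sense of \<open>continuous_map\<close>; its values outside \<open>X\<close> are never used.
\<close>

definition C0 :: "'a set \<Rightarrow> ('a \<Rightarrow> 'a \<Rightarrow> real) \<Rightarrow> ('a \<Rightarrow> real) set" where
  "C0 X d = {\<phi>. continuous_map (Metric_space.mtopology X d) euclideanreal \<phi>}"

definition birkhoff_sum :: "('a \<Rightarrow> 'a) \<Rightarrow> ('a \<Rightarrow> real) \<Rightarrow> nat \<Rightarrow> 'a \<Rightarrow> real" where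
  "birkhoff_sum f \<phi> n x = (\<Sum>i<n. \<phi> ((f ^^ i) x))"

definition irregular_set :: "'a set \<Rightarrow> ('a \<Rightarrow> 'a) \<Rightarrow> ('a \<Rightarrow> real) \<Rightarrow> 'a set" where
  "irregular_set X f \<phi> = {x \<in> X. \<not> convergent (\<lambda>n. 1 / real n * birkhoff_sum f \<phi> n x)}"

definition C0_hat :: "'a set \<Rightarrow> ('a \<Rightarrow> 'a \<Rightarrow> real) \<Rightarrow> ('a \<Rightarrow> 'a) \<Rightarrow> ('a \<Rightarrow> real) set" where
  "C0_hat X d f = {\<phi> \<in> C0 X d. irregular_set X f \<phi> \<noteq> {}}"

text \<open>The intersection is taken inside \<open>X\<close>, so that an empty family would give \<open>X\<close>, not \<open>UNIV\<close>.\<close>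

definition completely_irregular_set :: "'a set \<Rightarrow> ('a \<Rightarrow> 'a \<Rightarrow> real) \<Rightarrow> ('a \<Rightarrow> 'a) \<Rightarrow> 'a set" where
  "completely_irregular_set X d f = X \<inter> (\<Inter>\<phi>\<in>C0_hat X d f. irregular_set X f \<phi>)"


section \<open>Topological pressure, topological entropy and BS-dimension\<close>

definition bowen_ball ::
  "'a set \<Rightarrow> ('a \<Rightarrow> 'a \<Rightarrow> real) \<Rightarrow> ('a \<Rightarrow> 'a) \<Rightarrow> nat \<Rightarrow> 'a \<Rightarrow> real \<Rightarrow> 'a set" where
  "bowen_ball X d f m x \<epsilon> = {y \<in> X. \<forall>j<m. d ((f ^^ j) x) ((f ^^ j) y) \<le> \<epsilon>}"

text \<open>
  The weight of a ball depends on its length \<open>m\<close>, which the ball as a set does not determine.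
  A cover is therefore a countable set of pairs \<open>(x, m)\<close>, standing for the balls of length \<open>m\<close>
  around \<open>x\<close>.
\<close>

definition bowen_covers ::
  "'a set \<Rightarrow> ('a \<Rightarrow> 'a \<Rightarrow> real) \<Rightarrow> ('a \<Rightarrow> 'a) \<Rightarrow> nat \<Rightarrow> 'a set \<Rightarrow> real \<Rightarrow> ('a \<times> nat) set set" where
  "bowen_covers X d f n E \<epsilon> =
     {\<C>. countable \<C> \<and> \<C> \<subseteq> X \<times> {n..} \<and> E \<subseteq> (\<Union>(x, m)\<in>\<C>. bowen_ball X d f m x \<epsilon>)}"

text \<open>
  The suprema over Bowen balls below are suprema of nonempty bounded sets of reals when \<open>X\<close> is
  compact, \<open>f\<close> and \<open>\<phi>\<close> are continuous, \<open>f\<close> maps \<open>X\<close> to itself, and \<open>\<epsilon> \<ge> 0\<close>.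
  The sums over covers are taken in \<open>ennreal\<close>, where they always exist, and critical values are
  infima in \<open>ereal\<close>.  The limits in \<open>n\<close> exist by monotonicity; the limits in \<open>\<epsilon>\<close> exist by uniform
  continuity of \<open>\<phi>\<close>.
\<close>

definition pressure_C_n ::
  "'a set \<Rightarrow> ('a \<Rightarrow> 'a \<Rightarrow> real) \<Rightarrow> ('a \<Rightarrow> 'a) \<Rightarrow> 'a set \<Rightarrow> real \<Rightarrow> ('a \<Rightarrow> real) \<Rightarrow> nat \<Rightarrow> real \<Rightarrow> ennreal" where
  "pressure_C_n X d f E t \<phi> n \<epsilon> =
     (INF \<C>\<in>bowen_covers X d f n E \<epsilon>.
        \<Sum>\<^sub>\<infinity>(x, m)\<in>\<C>.
          ennreal (2 powr (- t * real m + (SUP y\<in>bowen_ball X d f m x \<epsilon>. birkhoff_sum f \<phi> m y))))"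

definition pressure_C ::
  "'a set \<Rightarrow> ('a \<Rightarrow> 'a \<Rightarrow> real) \<Rightarrow> ('a \<Rightarrow> 'a) \<Rightarrow> 'a set \<Rightarrow> real \<Rightarrow> ('a \<Rightarrow> real) \<Rightarrow> real \<Rightarrow> ennreal" where
  "pressure_C X d f E t \<phi> \<epsilon> = lim (\<lambda>n. pressure_C_n X d f E t \<phi> n \<epsilon>)"

definition pressure_at_scale ::
  "'a set \<Rightarrow> ('a \<Rightarrow> 'a \<Rightarrow> real) \<Rightarrow> ('a \<Rightarrow> 'a) \<Rightarrow> 'a set \<Rightarrow> ('a \<Rightarrow> real) \<Rightarrow> real \<Rightarrow> ereal" where
  "pressure_at_scale X d f E \<phi> \<epsilon> = Inf (ereal ` {t. pressure_C X d f E t \<phi> \<epsilon> = 0})"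

definition topological_pressure ::
  "'a set \<Rightarrow> ('a \<Rightarrow> 'a \<Rightarrow> real) \<Rightarrow> ('a \<Rightarrow> 'a) \<Rightarrow> 'a set \<Rightarrow> ('a \<Rightarrow> real) \<Rightarrow> ereal" where
  "topological_pressure X d f E \<phi> = Lim (at_right 0) (pressure_at_scale X d f E \<phi>)"

definition topological_entropy ::
  "'a set \<Rightarrow> ('a \<Rightarrow> 'a \<Rightarrow> real) \<Rightarrow> ('a \<Rightarrow> 'a) \<Rightarrow> 'a set \<Rightarrow> ereal" where
  "topological_entropy X d f E = topological_pressure X d f E (\<lambda>_. 0)"

definition BS_N_n ::
  "'a set \<Rightarrow> ('a \<Rightarrow> 'a \<Rightarrow> real) \<Rightarrow> ('a \<Rightarrow> 'a) \<Rightarrow> 'a set \<Rightarrow> real \<Rightarrow> ('a \<Rightarrow> real) \<Rightarrow> nat \<Rightarrow> real \<Rightarrow> ennreal" where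
  "BS_N_n X d f E t \<phi> n \<epsilon> =
     (INF \<C>\<in>bowen_covers X d f n E \<epsilon>.
        \<Sum>\<^sub>\<infinity>(x, m)\<in>\<C>.
          ennreal (2 powr (- t * (SUP y\<in>bowen_ball X d f m x \<epsilon>. birkhoff_sum f \<phi> m y))))"

definition BS_N ::
  "'a set \<Rightarrow> ('a \<Rightarrow> 'a \<Rightarrow> real) \<Rightarrow> ('a \<Rightarrow> 'a) \<Rightarrow> 'a set \<Rightarrow> real \<Rightarrow> ('a \<Rightarrow> real) \<Rightarrow> real \<Rightarrow> ennreal" where
  "BS_N X d f E t \<phi> \<epsilon> = lim (\<lambda>n. BS_N_n X d f E t \<phi> n \<epsilon>)"

definition BS_dimension_at_scale ::
  "'a set \<Rightarrow> ('a \<Rightarrow> 'a \<Rightarrow> real) \<Rightarrow> ('a \<Rightarrow> 'a) \<Rightarrow> 'a set \<Rightarrow> ('a \<Rightarrow> real) \<Rightarrow> real \<Rightarrow> ereal" where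
  "BS_dimension_at_scale X d f E \<phi> \<epsilon> = Inf (ereal ` {t. BS_N X d f E t \<phi> \<epsilon> = 0})"

definition BS_dimension ::
  "'a set \<Rightarrow> ('a \<Rightarrow> 'a \<Rightarrow> real) \<Rightarrow> ('a \<Rightarrow> 'a) \<Rightarrow> 'a set \<Rightarrow> ('a \<Rightarrow> real) \<Rightarrow> ereal" where
  "BS_dimension X d f E \<phi> = Lim (at_right 0) (BS_dimension_at_scale X d f E \<phi>)"


section \<open>Hausdorff dimension\<close>

definition ediam :: "('a \<Rightarrow> 'a \<Rightarrow> real) \<Rightarrow> 'a set \<Rightarrow> ennreal" where
  "ediam d U = (SUP x\<in>U. SUP y\<in>U. ennreal (d x y))"

definition hausdorff_premeasure ::
  "'a set \<Rightarrow> ('a \<Rightarrow> 'a \<Rightarrow> real) \<Rightarrow> real \<Rightarrow> real \<Rightarrow> 'a set \<Rightarrow> ennreal" where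
  "hausdorff_premeasure X d s \<delta> E =
     (INF \<U>\<in>{\<U>. countable \<U> \<and> \<U> \<subseteq> Pow X \<and> (\<forall>U\<in>\<U>. ediam d U \<le> ennreal \<delta>) \<and> E \<subseteq> \<Union>\<U>}.
        \<Sum>\<^sub>\<infinity>U\<in>\<U>. ennreal (enn2real (ediam d U) powr s))"

definition hausdorff_measure ::
  "'a set \<Rightarrow> ('a \<Rightarrow> 'a \<Rightarrow> real) \<Rightarrow> real \<Rightarrow> 'a set \<Rightarrow> ennreal" where
  "hausdorff_measure X d s E = Lim (at_right 0) (\<lambda>\<delta>. hausdorff_premeasure X d s \<delta> E)"

text \<open>
  Only exponents \<open>s > 0\<close> are used: \<open>0 powr 0 = 0\<close> would be the wrong convention for \<open>s = 0\<close>, and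
  leaving out \<open>s = 0\<close> does not change the infimum.
\<close>

definition hausdorff_dim :: "'a set \<Rightarrow> ('a \<Rightarrow> 'a \<Rightarrow> real) \<Rightarrow> 'a set \<Rightarrow> ereal" where
  "hausdorff_dim X d E = Inf (ereal ` {s. s > 0 \<and> hausdorff_measure X d s E = 0})"


section \<open>The beta-shift\<close>

text \<open>
  The digit \<open>a\<^sub>n\<close>, for \<open>n \<ge> 1\<close>; the value at \<open>0\<close> is irrelevant.  The argument of the floor function
  is nonnegative for \<open>\<beta> > 1\<close>, so \<open>nat\<close> does not truncate.
\<close>

fun beta_digit :: "real \<Rightarrow> nat \<Rightarrow> nat" where
  "beta_digit \<beta> n = nat \<lfloor>\<beta> ^ n - (\<Sum>i\<in>{1..<n}. real (beta_digit \<beta> i) * \<beta> ^ (n - i))\<rfloor>"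

declare beta_digit.simps [simp del]

text \<open>
  A sequence \<open>(x\<^sub>n)\<close> indexed by \<open>n \<ge> 1\<close> is represented by the function \<open>x\<close> with \<open>x n = x\<^sub>n\<^sub>+\<^sub>1\<close>.
\<close>

definition beta_expansion :: "real \<Rightarrow> nat \<Rightarrow> nat" where
  "beta_expansion \<beta> n = beta_digit \<beta> (n + 1)"

definition shift :: "(nat \<Rightarrow> 'a) \<Rightarrow> nat \<Rightarrow> 'a" where
  "shift x = (\<lambda>n. x (n + 1))"

definition lex_le :: "(nat \<Rightarrow> nat) \<Rightarrow> (nat \<Rightarrow> nat) \<Rightarrow> bool" where
  "lex_le x y \<longleftrightarrow> less_fun x y \<or> x = y"

definition beta_shift :: "real \<Rightarrow> (nat \<Rightarrow> nat) set" where
  "beta_shift \<beta> =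
     (if \<beta> \<in> \<int> then UNIV \<rightarrow> {..<nat \<lfloor>\<beta>\<rfloor>}
      else {x \<in> UNIV \<rightarrow> {..<nat \<lfloor>\<beta>\<rfloor> + 1}. \<forall>n. lex_le ((shift ^^ n) x) (beta_expansion \<beta>)})"

definition beta_dist :: "real \<Rightarrow> (nat \<Rightarrow> nat) \<Rightarrow> (nat \<Rightarrow> nat) \<Rightarrow> real" where
  "beta_dist \<beta> x y = (if x = y then 0 else 1 / \<beta> ^ (LEAST n. x n \<noteq> y n))"

lemma Metric_space_beta_dist:
  assumes "\<beta> > 1"
  shows "Metric_space (beta_shift \<beta>) (beta_dist \<beta>)"
proof
  fix x y z :: "nat \<Rightarrow> nat"
  show "0 \<le> beta_dist \<beta> x y"
    using assms by (simp add: beta_dist_def)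
  show "beta_dist \<beta> x y = beta_dist \<beta> y x"
    by (simp add: beta_dist_def eq_commute)
  show "(beta_dist \<beta> x y = 0) = (x = y)"
    using assms by (simp add: beta_dist_def)
  show "beta_dist \<beta> x z \<le> beta_dist \<beta> x y + beta_dist \<beta> y z"
  proof (cases "x = y \<or> y = z \<or> x = z")
    case True
    then show ?thesis
      using assms by (auto simp: beta_dist_def)
  next
    case False
    define l where "l = (LEAST n. x n \<noteq> z n)"
    from False have "\<exists>n. x n \<noteq> z n"
      by auto
    then have "x l \<noteq> z l"
      unfolding l_def by (rule LeastI_ex)
    then have "x l \<noteq> y l \<or> y l \<noteq> z l"
      by auto
    then have le: "(LEAST n. x n \<noteq> y n) \<le> l \<or> (LEAST n. y n \<noteq> z n) \<le> l"
      by (auto intro: Least_le)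
    have anti: "1 / \<beta> ^ l \<le> 1 / \<beta> ^ k" if "k \<le> l" for k
      using assms that by (intro divide_left_mono power_increasing) auto
    have nonneg: "0 \<le> 1 / \<beta> ^ k" for k
      using assms by simp
    have "1 / \<beta> ^ l \<le> 1 / \<beta> ^ (LEAST n. x n \<noteq> y n) + 1 / \<beta> ^ (LEAST n. y n \<noteq> z n)"
      using le
    proof
      assume "(LEAST n. x n \<noteq> y n) \<le> l"
      from add_mono[OF anti[OF this] nonneg] show ?thesis
        by simp
    next
      assume "(LEAST n. y n \<noteq> z n) \<le> l"
      from add_mono[OF nonneg anti[OF this]] show ?thesis
        by simp
    qed
    then show ?thesis
      using False by (simp add: beta_dist_def l_def)
  qed
qed

lemma shift_in_beta_shift:
  assumes "x \<in> beta_shift \<beta>"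
  shows "shift x \<in> beta_shift \<beta>"
proof -
  have "(shift ^^ n) (shift x) = (shift ^^ Suc n) x" for n
    by (simp only: funpow_Suc_right o_apply)
  then have "\<forall>n. lex_le ((shift ^^ n) (shift x)) a" if "\<forall>n. lex_le ((shift ^^ n) x) a" for a
    using that by metis
  moreover have "shift x \<in> UNIV \<rightarrow> A" if "x \<in> UNIV \<rightarrow> A" for A
    using that by (simp add: shift_def Pi_iff)
  ultimately show ?thesis
    using assms by (cases "\<beta> \<in> \<int>") (simp_all only: beta_shift_def if_True if_False mem_Collect_eq, blast)
qed

end

theory Submission
  imports Defs
begin

text \<open>
  Lowering the last nonzero letter of an admissible word makes it freely concatenable with all other
  such words; hence pieces of arbitrary points of \<open>\<Sigma>\<^sub>\<beta>\<close> can be glued at the cost of one wrong letter per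
  piece. Given \<open>z\<close> in \<open>\<Sigma>\<^sub>\<beta>\<close> and a large \<open>Q\<close>, overwrite \<open>z\<close> on the windows \<open>[Q 2\<^sup>j, (Q+1) 2\<^sup>j)\<close> by segments
  of periodic-like points, running infinitely often through a countable family that realises, up to
  small errors, all finite words. If the result \<open>x\<close> were regular for some \<open>\<phi>\<close>, then the averages of \<open>\<phi>\<close>
  over the windows would converge to the same limit as the averages over \<open>[0, n)\<close>, since the windows
  have a positive proportion; but if \<open>\<phi>\<close> has an irregular point, then two members of the family have
  separated averages. So \<open>x\<close> is completely irregular, and it agrees with \<open>z\<close> up to a proportion \<open>4/Q\<close>
  of the letters.

  Since Hamming balls of small relative radius contain only \<open>2\<^sup>\<delta>\<^sup>n\<close> words, and Birkhoff sums of a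
  continuous function vary by at most \<open>\<delta>n\<close> on them, every cover of the completely irregular set by
  Bowen balls can be turned into a cover of \<open>\<Sigma>\<^sub>\<beta>\<close> whose weights only change by factors \<open>2\<^sup>\<delta>\<^sup>n\<close>.
  This gives equality of all critical exponents; the Hausdorff dimension is the exponent for the
  weights \<open>\<beta>\<^sup>-\<^sup>s\<^sup>m\<close>.
\<close>

section \<open>Gluing in the beta-shift\<close>

lemma shift_pow [simp]: "(shift ^^ n) x i = x (n + i)"
  by (induction n arbitrary: i) (simp_all add: shift_def)

text \<open>The Hamming distance between prefixes of length \<open>n\<close>; all approximations
  below are measured by it.\<close>

definition mism :: "(nat \<Rightarrow> nat) \<Rightarrow> (nat \<Rightarrow> nat) \<Rightarrow> nat \<Rightarrow> nat" where
  "mism x y n = card {i. i < n \<and> x i \<noteq> y i}"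

lemma mism_mono: "m \<le> n \<Longrightarrow> mism x y m \<le> mism x y n"
  unfolding mism_def by (rule card_mono) auto

lemma mism_commute: "mism x y n = mism y x n"
  unfolding mism_def by metis

lemma mism_cong: "(\<And>i. i < n \<Longrightarrow> x i = x' i) \<Longrightarrow> (\<And>i. i < n \<Longrightarrow> y i = y' i) \<Longrightarrow> mism x y n = mism x' y' n"
  unfolding mism_def by (rule arg_cong[where f = card]) auto

lemma mism_add: "mism x y (m + n) = mism x y m + mism ((shift ^^ m) x) ((shift ^^ m) y) n"
proof -
  have "{i. i < m + n \<and> x i \<noteq> y i} = {i. i < m \<and> x i \<noteq> y i} \<union> (+) m ` {i. i < n \<and> x (m + i) \<noteq> y (m + i)}"
    (is "_ = ?A \<union> ?B")
  proof (intro equalityI subsetI)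
    fix i assume i: "i \<in> {i. i < m + n \<and> x i \<noteq> y i}"
    show "i \<in> ?A \<union> ?B"
    proof (cases "i < m")
      case False
      then have "i \<in> ?B" using i by (intro image_eqI[of _ _ "i - m"]) auto
      then show ?thesis ..
    qed (use i in auto)
  qed auto
  moreover have "card (?A \<union> ?B) = card ?A + card ?B" by (rule card_Un_disjoint) auto
  moreover have "card ?B = card {i. i < n \<and> x (m + i) \<noteq> y (m + i)}" by (rule card_image) simp
  ultimately show ?thesis by (simp add: mism_def)
qed

lemma mism_le: "mism x y n \<le> n"
proof -
  have "card {i. i < n \<and> x i \<noteq> y i} \<le> card {..<n}" by (rule card_mono) auto
  then show ?thesis by (simp add: mism_def)
qed

lemma mism_le_1:
  assumes "\<And>i. i < n \<Longrightarrow> i \<noteq> p \<Longrightarrow> x i = y i"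
  shows "mism x y n \<le> 1"
proof -
  have "{i. i < n \<and> x i \<noteq> y i} \<subseteq> {p}" using assms by blast
  then show ?thesis unfolding mism_def using card_mono[of "{p}"] by fastforce
qed

text \<open>A specification property that costs one wrong letter per piece, whatever the length of
  the piece. Since \<open>p\<close> may lie outside the piece, a piece may also be copied without
  error. Infinitely many pieces are glued at once, so no limit of finite gluings has to be
  taken.\<close>

definition gluing :: "(nat \<Rightarrow> nat) set \<Rightarrow> bool" where
  "gluing X \<longleftrightarrow> (\<forall>M z. strict_mono M \<longrightarrow> M 0 = 0 \<longrightarrow> (\<forall>j. z j \<in> X) \<longrightarrow>
     (\<exists>x\<in>X. \<forall>j::nat. \<exists>p. \<forall>i. M j + i < M (Suc j) \<longrightarrow> i \<noteq> p \<longrightarrow> x (M j + i) = z j i))"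

text \<open>\<open>J\<close> sends a position to the index of its piece, so that a concatenation can
  be written as one function of the position.\<close>

lemma ex_piece:
  fixes M :: "nat \<Rightarrow> nat"
  assumes "strict_mono M" "M 0 = 0"
  obtains J where "\<And>n. M (J n) \<le> n" "\<And>n. n < M (Suc (J n))"
    "\<And>j n. M j \<le> n \<Longrightarrow> n < M (Suc j) \<Longrightarrow> J n = j"
proof -
  define J where "J n = (LEAST j. n < M (Suc j))" for n
  have ex: "n < M (Suc n)" for n
    using strict_mono_imp_increasing[OF assms(1), of "Suc n"] by simp
  have 1: "n < M (Suc (J n))" for n
    unfolding J_def by (rule LeastI[of "\<lambda>j. n < M (Suc j)", OF ex])
  have 2: "M (J n) \<le> n" for n
  proof (cases "J n")
    case 0
    then show ?thesis using assms by simp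
  next
    case (Suc j)
    then have "\<not> n < M (Suc j)"
      unfolding J_def by (metis lessI not_less_Least)
    then show ?thesis using Suc by simp
  qed
  have 3: "J n = j" if "M j \<le> n" "n < M (Suc j)" for n j
  proof -
    have "J n \<le> j" unfolding J_def by (rule Least_le) (rule that)
    moreover have "j < Suc (J n)"
      using 1[of n] that(1) assms(1) by (meson le_less_trans strict_mono_less)
    ultimately show ?thesis by simp
  qed
  show ?thesis using 1 2 3 that by blast
qed

lemma gluing_full: "gluing (UNIV \<rightarrow> {..<k})"
  unfolding gluing_def
proof (intro allI impI)
  fix M :: "nat \<Rightarrow> nat" and z :: "nat \<Rightarrow> nat \<Rightarrow> nat"
  assume M: "strict_mono M" "M 0 = 0" and z: "\<forall>j. z j \<in> UNIV \<rightarrow> {..<k}"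
  obtain J where J: "\<And>n. M (J n) \<le> n" "\<And>n. n < M (Suc (J n))"
    "\<And>j n. M j \<le> n \<Longrightarrow> n < M (Suc j) \<Longrightarrow> J n = j"
    using ex_piece[OF M] by blast
  show "\<exists>x\<in>UNIV \<rightarrow> {..<k}. \<forall>j. \<exists>p. \<forall>i. M j + i < M (Suc j) \<longrightarrow> i \<noteq> p \<longrightarrow> x (M j + i) = z j i"
  proof (rule bexI[where x = "\<lambda>n. z (J n) (n - M (J n))"])
    show "(\<lambda>n. z (J n) (n - M (J n))) \<in> UNIV \<rightarrow> {..<k}"
      using z by (auto simp: Pi_iff)
  next
    have "z (J (M j + i)) (M j + i - M (J (M j + i))) = z j i" if "M j + i < M (Suc j)" for i j
      using J(3)[of j "M j + i"] that by simp
    then show "\<forall>j. \<exists>p. \<forall>i. M j + i < M (Suc j) \<longrightarrow> i \<noteq> p \<longrightarrow>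
        z (J (M j + i)) (M j + i - M (J (M j + i))) = z j i"
      by blast
  qed
qed

text \<open>Lowering the last nonzero letter of each piece makes every suffix of the piece strictly smaller
  than the corresponding prefix of \<open>a\<close>, so that the pieces may be concatenated freely.\<close>

lemma gluing_lex:
  fixes a :: "nat \<Rightarrow> nat"
  assumes a0: "a 0 > 0"
  shows "gluing {x \<in> UNIV \<rightarrow> {..<k}. \<forall>n. lex_le ((shift ^^ n) x) a}" (is "gluing ?X")
  unfolding gluing_def
proof (intro allI impI)
  fix M :: "nat \<Rightarrow> nat" and z :: "nat \<Rightarrow> nat \<Rightarrow> nat"
  assume M: "strict_mono M" "M 0 = 0" and z: "\<forall>j. z j \<in> ?X"
  obtain J where J: "\<And>n. M (J n) \<le> n" "\<And>n. n < M (Suc (J n))"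
    "\<And>j n. M j \<le> n \<Longrightarrow> n < M (Suc j) \<Longrightarrow> J n = j"
    using ex_piece[OF M] by blast
  define P where "P j = {i. M j + i < M (Suc j) \<and> z j i \<noteq> 0}" for j
  define p where "p j = Max (P j)" for j
  \<comment> \<open>If piece \<open>j\<close> is zero throughout, \<open>p j\<close> is an
    unspecified \<open>Max {}\<close>; truncated subtraction keeps 0 at 0, so this does no
    harm.\<close>
  define s where "s j i = (if i = p j then z j i - 1 else z j i)" for j i
  define x where "x n = s (J n) (n - M (J n))" for n
  have fin: "finite (P j)" for j
    unfolding P_def by (rule finite_subset[of _ "{..<M (Suc j)}"]) auto
  have x_eq: "x (M j + i) = s j i" if "M j + i < M (Suc j)" for i j
    using J(3)[of j "M j + i"] that by (simp add: x_def)
  have "x n < k" for n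
  proof -
    have "z (J n) (n - M (J n)) < k" using z by (auto simp: Pi_iff)
    then show ?thesis by (auto simp: x_def s_def)
  qed
  moreover have "less_fun ((shift ^^ n) x) a" for n
  proof -
    define j i where "j = J n" and "i = n - M j"
    have n: "n = M j + i" "M j + i < M (Suc j)"
      using J(1,2)[of n] by (simp_all add: i_def j_def)
    show ?thesis
    \<comment> \<open>Up to the lowered letter, the tail of \<open>x\<close> first differs from the
      tail of \<open>z j\<close> at that letter and is smaller there, whatever comes later. Beyond
      it, or in a zero piece, the tail starts with 0 and lies below \<open>a\<close> because
      \<open>a 0 > 0\<close>.\<close>
    proof (cases "P j \<noteq> {} \<and> i \<le> p j")
      case True
      then have pP: "p j \<in> P j" using fin by (simp add: p_def)
      then have len: "M j + p j < M (Suc j)" by (simp add: P_def)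
      have "less_fun ((shift ^^ n) x) ((shift ^^ i) (z j))"
      proof (intro less_funI exI[of _ "p j - i"] conjI allI impI)
        have "x (n + (p j - i)) = s j (p j)"
          using True n x_eq[OF len] by simp
        then show "(shift ^^ n) x (p j - i) < (shift ^^ i) (z j) (p j - i)"
          using True pP by (simp add: s_def P_def)
        fix l assume l: "l < p j - i"
        then have "x (M j + (i + l)) = s j (i + l)"
          using len by (intro x_eq) simp
        then show "(shift ^^ n) x l = (shift ^^ i) (z j) l"
          using l n by (simp add: s_def add.assoc)
      qed
      moreover have "lex_le ((shift ^^ i) (z j)) a" using z by blast
      ultimately show ?thesis
        unfolding lex_le_def by (auto intro: less_fun_trans)
    next
      case False
      have "z j i = 0"
      proof (rule ccontr)
        assume "z j i \<noteq> 0"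
        then have "i \<in> P j" using n by (simp add: P_def)
        then show False using False fin by (auto simp: p_def)
      qed
      then have "x n = 0"
        using n x_eq[OF n(2)] by (auto simp: s_def split: if_splits)
      then show ?thesis
        using a0 by (intro less_funI exI[of _ 0]) simp
    qed
  qed
  ultimately have "x \<in> ?X" by (auto simp: lex_le_def)
  moreover have "\<forall>j. \<exists>p. \<forall>i. M j + i < M (Suc j) \<longrightarrow> i \<noteq> p \<longrightarrow> x (M j + i) = z j i"
    using x_eq by (auto simp: s_def intro!: exI)
  ultimately show "\<exists>x\<in>?X. \<forall>j. \<exists>p. \<forall>i. M j + i < M (Suc j) \<longrightarrow> i \<noteq> p \<longrightarrow> x (M j + i) = z j i"
    by blast
qed

text \<open>Closedness in the product topology, stated through prefixes: the hypothesis on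
  \<open>x\<close> says that every cylinder around \<open>x\<close> meets \<open>X\<close>.\<close>

definition closed_shift :: "(nat \<Rightarrow> nat) set \<Rightarrow> bool" where
  "closed_shift X \<longleftrightarrow> (\<forall>x. (\<forall>n. \<exists>y\<in>X. \<forall>i<n. y i = x i) \<longrightarrow> x \<in> X)"

text \<open>The comparison is decided at the first difference, so a violation of the order is
  already visible in a finite prefix: the complement is open.\<close>

lemma not_lex_le_prefix:
  assumes "\<not> lex_le x a"
  obtains n where "\<And>y. (\<forall>i<n. y i = x i) \<Longrightarrow> \<not> lex_le y a"
proof -
  have "x \<noteq> a" using assms by (auto simp: lex_le_def)
  define l where "l = (LEAST i. x i \<noteq> a i)"
  have l: "x l \<noteq> a l"
    unfolding l_def by (rule LeastI_ex) (use \<open>x \<noteq> a\<close> in auto)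
  have eq: "x i = a i" if "i < l" for i
    using that not_less_Least unfolding l_def by blast
  have "\<not> x l < a l"
    using assms eq unfolding lex_le_def less_fun_def by blast
  then have "a l < x l" using l by simp
  show ?thesis
  proof (rule that[of "Suc l"])
    fix y assume y: "\<forall>i<Suc l. y i = x i"
    then have "less_fun a y"
      using eq \<open>a l < x l\<close> by (intro less_funI exI[of _ l]) simp
    then show "\<not> lex_le y a"
      unfolding lex_le_def using less_fun_asym less_fun_irrefl by blast
  qed
qed

lemma closed_shift_full: "closed_shift (UNIV \<rightarrow> {..<k})"
  unfolding closed_shift_def
proof (intro allI impI)
  fix x :: "nat \<Rightarrow> nat" assume x: "\<forall>n. \<exists>y\<in>UNIV \<rightarrow> {..<k}. \<forall>i<n. y i = x i"
  have "x i < k" for i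
  proof -
    obtain y where "y \<in> UNIV \<rightarrow> {..<k}" "\<forall>l<Suc i. y l = x l" using x by blast
    then show ?thesis by (metis PiE UNIV_I lessI lessThan_iff)
  qed
  then show "x \<in> UNIV \<rightarrow> {..<k}" by simp
qed

lemma closed_shift_lex:
  "closed_shift {x \<in> UNIV \<rightarrow> {..<k}. \<forall>n. lex_le ((shift ^^ n) x) a}" (is "closed_shift ?X")
  unfolding closed_shift_def
proof (intro allI impI)
  fix x assume x: "\<forall>n. \<exists>y\<in>?X. \<forall>i<n. y i = x i"
  then have "x \<in> UNIV \<rightarrow> {..<k}"
    by (intro closed_shift_full[unfolded closed_shift_def, rule_format]) blast
  moreover have "lex_le ((shift ^^ n) x) a" for n
  proof (rule ccontr)
    assume "\<not> ?thesis"
    then obtain l where l: "\<And>y. (\<forall>i<l. y i = (shift ^^ n) x i) \<Longrightarrow> \<not> lex_le y a"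
      using not_lex_le_prefix by metis
    obtain y where y: "y \<in> ?X" "\<forall>i<n + l. y i = x i" using x by blast
    then have "\<not> lex_le ((shift ^^ n) y) a" by (intro l) simp
    then show False using y(1) by blast
  qed
  ultimately show "x \<in> ?X" by blast
qed

text \<open>The first digit is the integer part of \<beta>, hence at least 1. This is what
  \<open>gluing_lex\<close> asks of \<open>a\<close>.\<close>

lemma beta_expansion_0:
  assumes "\<beta> > 1"
  shows "beta_expansion \<beta> 0 > 0"
  using assms by (simp add: beta_expansion_def beta_digit.simps[of \<beta> "Suc 0"])

lemma beta_shift_structure:
  assumes "\<beta> > 1"
  obtains k where "beta_shift \<beta> \<subseteq> UNIV \<rightarrow> {..<k}" "gluing (beta_shift \<beta>)" "closed_shift (beta_shift \<beta>)"
proof (cases "\<beta> \<in> \<int>")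
  case True
  then have "beta_shift \<beta> = UNIV \<rightarrow> {..<nat \<lfloor>\<beta>\<rfloor>}" by (simp add: beta_shift_def)
  then show ?thesis
    using assms gluing_full closed_shift_full by (intro that[of "nat \<lfloor>\<beta>\<rfloor>"]) auto
next
  case False
  then have *: "beta_shift \<beta> = {x \<in> UNIV \<rightarrow> {..<nat \<lfloor>\<beta>\<rfloor> + 1}. \<forall>n. lex_le ((shift ^^ n) x) (beta_expansion \<beta>)}"
    by (simp add: beta_shift_def)
  show ?thesis
    using gluing_lex[where a = "beta_expansion \<beta>", OF beta_expansion_0[OF assms]] closed_shift_lex
    by (intro that[of "nat \<lfloor>\<beta>\<rfloor> + 1"]) (simp_all only: *, blast)
qed

section \<open>Continuous functions and Birkhoff sums\<close>

text \<open>The metric takes only the value 0 and powers of \<open>1 / \<beta>\<close>, so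
  \<epsilon> matters only through the least \<open>N\<close> whose power is at most
  \<epsilon>.\<close>

lemma beta_dist_le_iff:
  assumes "\<beta> > 1" "1 / \<beta> ^ N \<le> \<epsilon>" "\<And>n. n < N \<Longrightarrow> \<epsilon> < 1 / \<beta> ^ n"
  shows "beta_dist \<beta> x y \<le> \<epsilon> \<longleftrightarrow> (\<forall>i<N. x i = y i)"
proof (cases "x = y")
  case True
  have "0 < 1 / \<beta> ^ N" using assms(1) by simp
  then have "0 \<le> \<epsilon>" using assms(2) by linarith
  with True show ?thesis by (simp add: beta_dist_def)
next
  case False
  define l where "l = (LEAST n. x n \<noteq> y n)"
  have l: "x l \<noteq> y l"
    unfolding l_def by (rule LeastI_ex) (use False in auto)
  have eq: "x i = y i" if "i < l" for i
    using that not_less_Least unfolding l_def by blast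
  have "beta_dist \<beta> x y = 1 / \<beta> ^ l" using False by (simp add: beta_dist_def l_def)
  moreover have "1 / \<beta> ^ l \<le> 1 / \<beta> ^ N" if "N \<le> l"
    using assms(1) that by (intro divide_left_mono power_increasing) auto
  moreover have "N \<le> l" if "1 / \<beta> ^ l \<le> \<epsilon>"
    using assms(3)[of l] that by (meson not_le)
  moreover have "N \<le> l \<longleftrightarrow> (\<forall>i<N. x i = y i)"
    using l eq by (meson le_less_linear less_le_trans)
  ultimately show ?thesis using assms(2) by (metis order_trans)
qed

lemma beta_dist_le_power:
  assumes "\<beta> > 1"
  shows "beta_dist \<beta> x y \<le> 1 / \<beta> ^ N \<longleftrightarrow> (\<forall>i<N. x i = y i)"
  using assms by (intro beta_dist_le_iff) (auto intro!: divide_strict_left_mono power_strict_increasing)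

text \<open>For \<epsilon> below 1 the threshold is positive, hence of the form
  \<open>Suc r\<close>; \<open>r\<close> is the excess of the cylinder length over the length of a
  Bowen ball.\<close>

lemma beta_dist_le_scale:
  assumes "\<beta> > 1" "0 < \<epsilon>" "\<epsilon> < 1"
  obtains r where "\<And>x y. beta_dist \<beta> x y \<le> \<epsilon> \<longleftrightarrow> (\<forall>i<Suc r. x i = y i)"
proof -
  define N where "N = (LEAST N. 1 / \<beta> ^ N \<le> \<epsilon>)"
  have "\<exists>N. (1 / \<beta>) ^ N < \<epsilon>"
    using assms by (intro real_arch_pow_inv) auto
  then have "\<exists>N. 1 / \<beta> ^ N \<le> \<epsilon>"
    by (metis less_imp_le power_one_over)
  then have N: "1 / \<beta> ^ N \<le> \<epsilon>" unfolding N_def by (rule LeastI_ex)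
  have N': "\<epsilon> < 1 / \<beta> ^ n" if "n < N" for n
    using not_less_Least[of n "\<lambda>N. 1 / \<beta> ^ N \<le> \<epsilon>"] that unfolding N_def by simp
  have "N \<noteq> 0" using N assms by (cases N) auto
  then obtain r where "N = Suc r" by (cases N) auto
  then show ?thesis using beta_dist_le_iff[OF assms(1) N N'] that by metis
qed

lemma beta_dist_ge:
  assumes "\<beta> > 1" "x m \<noteq> y m"
  shows "1 / \<beta> ^ m \<le> beta_dist \<beta> x y"
proof -
  have "(LEAST n. x n \<noteq> y n) \<le> m" using assms(2) by (rule Least_le)
  then show ?thesis
    using assms by (auto simp: beta_dist_def intro!: divide_left_mono power_increasing)
qed

lemma birkhoff_sum_add:
  "birkhoff_sum f \<phi> (m + n) x = birkhoff_sum f \<phi> m x + birkhoff_sum f \<phi> n ((f ^^ m) x)"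
proof -
  have "birkhoff_sum f \<phi> (m + n) x = (\<Sum>i<m. \<phi> ((f ^^ i) x)) + (\<Sum>i=m..<m+n. \<phi> ((f ^^ i) x))"
    unfolding birkhoff_sum_def by (simp add: sum.atLeastLessThan_concat lessThan_atLeast0)
  also have "(\<Sum>i=m..<m+n. \<phi> ((f ^^ i) x)) = (\<Sum>i<n. \<phi> ((f ^^ (m + i)) x))"
    using sum.shift_bounds_nat_ivl[of "\<lambda>i. \<phi> ((f ^^ i) x)" 0 m n]
    by (simp add: add.commute lessThan_atLeast0)
  finally show ?thesis
    by (simp add: birkhoff_sum_def funpow_add o_def add.commute[of m])
qed

lemma birkhoff_uminus: "birkhoff_sum f (\<lambda>x. - \<phi> x) n x = - birkhoff_sum f \<phi> n x"
  by (simp add: birkhoff_sum_def sum_negf)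

text \<open>These properties hold in both cases of the definition of \<open>beta_shift\<close>, so
  integer and non-integer \<beta> are treated together from here on.\<close>

locale gluing_shift =
  fixes X :: "(nat \<Rightarrow> nat) set" and k :: nat and \<beta> :: real
  assumes beta_gt_1: "\<beta> > 1"
    and alphabet: "X \<subseteq> UNIV \<rightarrow> {..<k}"
    and shift_mem: "x \<in> X \<Longrightarrow> shift x \<in> X"
    and closed: "closed_shift X"
    and gluing: "gluing X"
    and metric: "Metric_space X (beta_dist \<beta>)"
begin

abbreviation d :: "(nat \<Rightarrow> nat) \<Rightarrow> (nat \<Rightarrow> nat) \<Rightarrow> real" where
  "d \<equiv> beta_dist \<beta>"

abbreviation S :: "((nat \<Rightarrow> nat) \<Rightarrow> real) \<Rightarrow> nat \<Rightarrow> (nat \<Rightarrow> nat) \<Rightarrow> real" where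
  "S \<equiv> birkhoff_sum shift"

section \<open>Compactness of the shift space and uniform continuity\<close>

lemma shift_pow_mem: "x \<in> X \<Longrightarrow> (shift ^^ n) x \<in> X"
  by (induction n) (auto intro: shift_mem)

text \<open>The full shift on \<open>k\<close> letters is compact by Tychonoff's theorem, and
  convergence of a discrete coordinate means that it is eventually constant. Closedness puts the
  cluster point into \<open>X\<close>.\<close>

lemma cluster_point:
  assumes "\<And>n. u n \<in> X"
  obtains v where "v \<in> X" "\<And>n. \<exists>m\<ge>n. \<forall>i<n. u m i = v i"
proof -
  have "compactin (product_topology (\<lambda>i::nat. euclidean :: nat topology) UNIV) (PiE UNIV (\<lambda>_. {..<k}))"
    unfolding compactin_PiE by (auto intro: finite_imp_compact)
  then have "compact (UNIV \<rightarrow> {..<k} :: (nat \<Rightarrow> nat) set)"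
    by (simp add: euclidean_product_topology PiE_UNIV_domain)
  then have "seq_compact (UNIV \<rightarrow> {..<k} :: (nat \<Rightarrow> nat) set)"
    by (rule compact_imp_seq_compact)
  moreover have "\<forall>n. u n \<in> UNIV \<rightarrow> {..<k}" using assms alphabet by blast
  ultimately obtain v r where r: "strict_mono r" and v: "(u \<circ> r) \<longlonglongrightarrow> v"
    by (rule seq_compactE) blast
  have "(\<lambda>m. u (r m) i) \<longlonglongrightarrow> v i" for i
    using continuous_on_tendsto_compose[OF continuous_on_product_coordinates[of i] v] by simp
  then have ev: "\<forall>\<^sub>F m in sequentially. u (r m) i = v i" for i
    by (simp add: tendsto_discrete)
  have *: "\<exists>m\<ge>n. \<forall>i<n. u m i = v i" for n
  proof -
    have "\<forall>\<^sub>F m in sequentially. \<forall>i\<in>{..<n}. u (r m) i = v i"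
      using ev by (intro eventually_ball_finite) auto
    then have "\<forall>\<^sub>F m in sequentially. (\<forall>i\<in>{..<n}. u (r m) i = v i) \<and> m \<ge> n"
      by (intro eventually_conj eventually_ge_at_top)
    from eventually_happens'[OF sequentially_bot this]
    obtain m where "\<forall>i\<in>{..<n}. u (r m) i = v i" "m \<ge> n" by blast
    then show ?thesis
      using seq_suble[OF r, of m] by (intro exI[of _ "r m"]) auto
  qed
  have "v \<in> X"
    using closed assms * unfolding closed_shift_def by metis
  with * show ?thesis using that by blast
qed

lemma C0_local:
  assumes "\<phi> \<in> C0 X d" "v \<in> X" "\<eta> > 0"
  obtains L where "\<And>y. y \<in> X \<Longrightarrow> (\<And>i. i < L \<Longrightarrow> y i = v i) \<Longrightarrow> \<bar>\<phi> y - \<phi> v\<bar> < \<eta>"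
proof -
  interpret Metric_space X d by (rule metric)
  have "continuous_map mtopology euclideanreal \<phi>" using assms by (simp add: C0_def)
  then have "openin mtopology {x \<in> X. \<phi> x \<in> ball (\<phi> v) \<eta>}"
    unfolding continuous_map_def topspace_mtopology by (metis open_ball open_openin)
  then obtain e where e: "e > 0" "mball v e \<subseteq> {x \<in> X. \<phi> x \<in> ball (\<phi> v) \<eta>}"
    unfolding openin_mtopology using assms by force
  obtain L where L: "(1 / \<beta>) ^ L < e"
    using real_arch_pow_inv[of e "1 / \<beta>"] e(1) beta_gt_1 by auto
  show ?thesis
  proof (rule that[of L])
    fix y assume y: "y \<in> X" "\<And>i. i < L \<Longrightarrow> y i = v i"
    then have "d v y \<le> 1 / \<beta> ^ L" using beta_dist_le_power[OF beta_gt_1] by metis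
    also have "\<dots> < e" using L by (simp add: power_one_over)
    finally have "y \<in> mball v e" using y(1) assms(2) by (simp add: in_mball)
    then show "\<bar>\<phi> y - \<phi> v\<bar> < \<eta>" using e(2) by (auto simp: dist_real_def abs_minus_commute)
  qed
qed

text \<open>Boundedness and uniform continuity in terms of prefixes. Unlike the topological form,
  this is applied directly to letters, and it passes at once to the negated function.\<close>

definition tame :: "((nat \<Rightarrow> nat) \<Rightarrow> real) \<Rightarrow> bool" where
  "tame \<phi> \<longleftrightarrow> (\<exists>B. \<forall>x\<in>X. \<bar>\<phi> x\<bar> \<le> B) \<and>
     (\<forall>\<eta>>0. \<exists>L. \<forall>x\<in>X. \<forall>y\<in>X. (\<forall>i<L. x i = y i) \<longrightarrow> \<bar>\<phi> x - \<phi> y\<bar> \<le> \<eta>)"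

lemma tame_bounded:
  assumes "tame \<phi>"
  obtains B where "\<And>x. x \<in> X \<Longrightarrow> \<bar>\<phi> x\<bar> \<le> B"
proof -
  from assms obtain B where "\<forall>x\<in>X. \<bar>\<phi> x\<bar> \<le> B" unfolding tame_def by (elim conjE exE)
  then show ?thesis using that by blast
qed

lemma tame_local:
  assumes "tame \<phi>" "\<eta> > 0"
  obtains L where "\<And>x y. x \<in> X \<Longrightarrow> y \<in> X \<Longrightarrow> (\<forall>i<L. x i = y i) \<Longrightarrow> \<bar>\<phi> x - \<phi> y\<bar> \<le> \<eta>"
proof -
  have "\<forall>\<eta>>0. \<exists>L. \<forall>x\<in>X. \<forall>y\<in>X. (\<forall>i<L. x i = y i) \<longrightarrow> \<bar>\<phi> x - \<phi> y\<bar> \<le> \<eta>"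
    using assms(1) unfolding tame_def by (elim conjE)
  then obtain L where "\<forall>x\<in>X. \<forall>y\<in>X. (\<forall>i<L. x i = y i) \<longrightarrow> \<bar>\<phi> x - \<phi> y\<bar> \<le> \<eta>"
    using assms(2) by auto
  then show ?thesis by (intro that) blast
qed

lemma tame_uminus: "tame \<phi> \<Longrightarrow> tame (\<lambda>x. - \<phi> x)"
  unfolding tame_def by (simp add: abs_minus_commute)

text \<open>Each failure yields a sequence of counterexamples; continuity at a cluster point of it
  gives the contradiction.\<close>

lemma C0_tame:
  assumes \<phi>: "\<phi> \<in> C0 X d"
  shows "tame \<phi>"
  unfolding tame_def
proof (intro conjI allI impI)
  show "\<exists>B. \<forall>x\<in>X. \<bar>\<phi> x\<bar> \<le> B"
  proof (rule ccontr)
    assume "\<not> ?thesis"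
    then have "\<forall>n. \<exists>x\<in>X. \<bar>\<phi> x\<bar> > real n" by (meson not_le)
    then obtain u where u: "\<And>n. u n \<in> X" "\<And>n. \<bar>\<phi> (u n)\<bar> > real n" by metis
    then obtain v where v: "v \<in> X" "\<And>n. \<exists>m\<ge>n. \<forall>i<n. u m i = v i"
      using cluster_point by metis
    obtain L where L: "\<And>y. y \<in> X \<Longrightarrow> (\<And>i. i < L \<Longrightarrow> y i = v i) \<Longrightarrow> \<bar>\<phi> y - \<phi> v\<bar> < 1"
      using C0_local[OF \<phi> v(1), of 1] by auto
    obtain n where n: "real n > \<bar>\<phi> v\<bar> + 1" using reals_Archimedean2 by blast
    obtain m where m: "m \<ge> max n L" "\<forall>i<max n L. u m i = v i" using v(2) by blast
    have "\<bar>\<phi> (u m) - \<phi> v\<bar> < 1" using m by (intro L u) auto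
    moreover have "\<bar>\<phi> (u m)\<bar> > real n" using u(2)[of m] m(1) by linarith
    ultimately show False using n by linarith
  qed
next
  fix \<eta> :: real assume \<eta>: "\<eta> > 0"
  show "\<exists>L. \<forall>x\<in>X. \<forall>y\<in>X. (\<forall>i<L. x i = y i) \<longrightarrow> \<bar>\<phi> x - \<phi> y\<bar> \<le> \<eta>"
  proof (rule ccontr)
    assume "\<not> ?thesis"
    then have "\<forall>n. \<exists>x y. x \<in> X \<and> y \<in> X \<and> (\<forall>i<n. x i = y i) \<and> \<bar>\<phi> x - \<phi> y\<bar> > \<eta>"
      by (meson not_le)
    then obtain u w where u: "\<And>n. u n \<in> X" "\<And>n. w n \<in> X" "\<And>n. \<forall>i<n. u n i = w n i"
      "\<And>n. \<bar>\<phi> (u n) - \<phi> (w n)\<bar> > \<eta>" by metis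
    then obtain v where v: "v \<in> X" "\<And>n. \<exists>m\<ge>n. \<forall>i<n. u m i = v i"
      using cluster_point by metis
    obtain L where L: "\<And>y. y \<in> X \<Longrightarrow> (\<And>i. i < L \<Longrightarrow> y i = v i) \<Longrightarrow> \<bar>\<phi> y - \<phi> v\<bar> < \<eta> / 2"
      using C0_local[OF \<phi> v(1), of "\<eta> / 2"] \<eta> by auto
    obtain m where m: "m \<ge> L" "\<forall>i<L. u m i = v i" using v(2) by blast
    have "w m i = v i" if "i < L" for i
      using m u(3)[of m] that by (metis less_le_trans)
    then have "\<bar>\<phi> (w m) - \<phi> v\<bar> < \<eta> / 2" by (intro L u)
    moreover have "\<bar>\<phi> (u m) - \<phi> v\<bar> < \<eta> / 2" using m by (intro L u) auto
    ultimately show False using u(4)[of m] by linarith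
  qed
qed

lemma C0_pos_lower_bound:
  assumes \<phi>: "\<phi> \<in> C0 X d" and pos: "\<And>x. x \<in> X \<Longrightarrow> \<phi> x > 0"
  obtains c where "c > 0" "\<And>x. x \<in> X \<Longrightarrow> \<phi> x \<ge> c"
proof (rule ccontr)
  assume "\<not> thesis"
  then have "\<forall>n. \<exists>x\<in>X. \<phi> x < 1 / real (Suc n)"
    using that by (metis not_le of_nat_0_less_iff zero_less_Suc zero_less_divide_1_iff)
  then obtain u where u: "\<And>n. u n \<in> X" "\<And>n. \<phi> (u n) < 1 / real (Suc n)" by metis
  then obtain v where v: "v \<in> X" "\<And>n. \<exists>m\<ge>n. \<forall>i<n. u m i = v i"
    using cluster_point by metis
  obtain L where L: "\<And>y. y \<in> X \<Longrightarrow> (\<And>i. i < L \<Longrightarrow> y i = v i) \<Longrightarrow> \<bar>\<phi> y - \<phi> v\<bar> < \<phi> v / 2"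
    using C0_local[OF \<phi> v(1), of "\<phi> v / 2"] pos[OF v(1)] by auto
  obtain n where n: "1 / real (Suc n) < \<phi> v / 2"
    using reals_Archimedean[of "\<phi> v / 2"] pos[OF v(1)] by (auto simp: inverse_eq_divide)
  obtain m where m: "m \<ge> max n L" "\<forall>i<max n L. u m i = v i" using v(2) by blast
  have "\<bar>\<phi> (u m) - \<phi> v\<bar> < \<phi> v / 2" using m by (intro L u) auto
  moreover have "1 / real (Suc m) \<le> 1 / real (Suc n)" using m(1) by (intro divide_left_mono) auto
  ultimately show False using n u(2)[of m] by linarith
qed

text \<open>An index is bad if the window of \<open>L\<close> letters starting there contains a
  mismatch. Each mismatch spoils at most \<open>L\<close> windows, and at most \<open>L\<close>
  windows reach beyond \<open>m\<close>, which accounts for the \<open>+ 1\<close>. Bad indices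
  contribute at most \<open>2 * B\<close>, the others at most \<eta>.\<close>

lemma birkhoff_diff_le:
  assumes x: "x \<in> X" and y: "y \<in> X" and B: "\<And>x. x \<in> X \<Longrightarrow> \<bar>\<phi> x\<bar> \<le> B"
    and L: "\<And>x y. x \<in> X \<Longrightarrow> y \<in> X \<Longrightarrow> (\<forall>i<L. x i = y i) \<Longrightarrow> \<bar>\<phi> x - \<phi> y\<bar> \<le> \<eta>"
    and "\<eta> \<ge> 0"
  shows "\<bar>S \<phi> m x - S \<phi> m y\<bar> \<le> \<eta> * m + 2 * B * L * (real (mism x y m) + 1)"
proof -
  define bad where "bad = {i. i < m \<and> (\<exists>l<L. x (i + l) \<noteq> y (i + l))}"
  have B0: "B \<ge> 0" using B[OF x] by simp
  \<comment> \<open>A bad index is recovered from the mismatch \<open>p\<close> and its offset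
    \<open>l\<close> in the window as \<open>p - l\<close>, unless the mismatch lies at or beyond
    \<open>m\<close>.\<close>
  have "bad \<subseteq> (\<lambda>(p, l). p - l) ` ({i. i < m \<and> x i \<noteq> y i} \<times> {..<L}) \<union> {m - L..<m}" (is "_ \<subseteq> ?U")
  proof
    fix i assume "i \<in> bad"
    then obtain l where l: "i < m" "l < L" "x (i + l) \<noteq> y (i + l)" by (auto simp: bad_def)
    show "i \<in> ?U"
    proof (cases "i + l < m")
      case True
      then have "i \<in> (\<lambda>(p, l). p - l) ` ({i. i < m \<and> x i \<noteq> y i} \<times> {..<L})"
        using l by (intro image_eqI[of _ _ "(i + l, l)"]) auto
      then show ?thesis by blast
    next
      case False
      then have "i \<in> {m - L..<m}" using l by auto
      then show ?thesis by blast
    qed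
  qed
  then have "card bad \<le> card ?U" by (rule card_mono[rotated]) simp
  also have "\<dots> \<le> card ((\<lambda>(p, l). p - l) ` ({i. i < m \<and> x i \<noteq> y i} \<times> {..<L})) + card {m - L..<m}"
    by (rule card_Un_le)
  also have "\<dots> \<le> mism x y m * L + L"
  proof (rule add_mono)
    show "card ((\<lambda>(p, l). p - l) ` ({i. i < m \<and> x i \<noteq> y i} \<times> {..<L})) \<le> mism x y m * L"
      using card_image_le[of "{i. i < m \<and> x i \<noteq> y i} \<times> {..<L}" "\<lambda>(p, l). p - l"]
      by (simp add: mism_def card_cartesian_product)
  qed simp
  finally have "real (card bad) \<le> real (mism x y m * L + L)" by (rule of_nat_mono)
  then have card: "real (card bad) \<le> L * (real (mism x y m) + 1)" by (simp add: algebra_simps)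
  have "\<bar>S \<phi> m x - S \<phi> m y\<bar> = \<bar>\<Sum>i<m. \<phi> ((shift ^^ i) x) - \<phi> ((shift ^^ i) y)\<bar>"
    by (simp add: birkhoff_sum_def sum_subtractf)
  also have "\<dots> \<le> (\<Sum>i<m. \<bar>\<phi> ((shift ^^ i) x) - \<phi> ((shift ^^ i) y)\<bar>)"
    by (rule sum_abs)
  also have "\<dots> \<le> (\<Sum>i<m. \<eta> + (if i \<in> bad then 2 * B else 0))"
  proof (rule sum_mono)
    fix i assume i: "i \<in> {..<m}"
    show "\<bar>\<phi> ((shift ^^ i) x) - \<phi> ((shift ^^ i) y)\<bar> \<le> \<eta> + (if i \<in> bad then 2 * B else 0)"
    proof (cases "i \<in> bad")
      case True
      then show ?thesis
        using B[OF shift_pow_mem[OF x, of i]] B[OF shift_pow_mem[OF y, of i]] \<open>\<eta> \<ge> 0\<close> by simp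
    next
      case False
      then show ?thesis
        using i by (auto simp: bad_def intro!: L shift_pow_mem x y)
    qed
  qed
  also have "\<dots> = \<eta> * m + 2 * B * card bad"
    by (simp add: sum.distrib sum.If_cases bad_def Int_def)
  also have "\<dots> \<le> \<eta> * m + 2 * B * (L * (real (mism x y m) + 1))"
    using card B0 by (intro add_left_mono mult_left_mono) auto
  finally show ?thesis by (simp add: mult.assoc)
qed

end

section \<open>Points that repeat a word\<close>

text \<open>Boundedness gives a cluster point \<open>l\<close>. As the sequence does not converge to
  \<open>l\<close>, it is infinitely often at distance at least \<open>e\<close> on one fixed side;
  both levels are placed between \<open>l\<close> and that side.\<close>

lemma bounded_oscillation:
  fixes a :: "nat \<Rightarrow> real"
  assumes "bounded (range a)" "\<not> convergent a"
  obtains b1 b2 where "b1 < b2" "\<exists>\<^sub>F n in sequentially. a n < b1" "\<exists>\<^sub>F n in sequentially. a n > b2"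
proof -
  obtain l r where r: "strict_mono r" and l: "(a \<circ> r) \<longlonglongrightarrow> l"
    using bounded_imp_convergent_subsequence[OF assms(1)] by blast
  have "\<not> a \<longlonglongrightarrow> l" using assms(2) by (auto simp: convergent_def)
  then obtain e where e: "e > 0" "\<not> (\<forall>\<^sub>F n in sequentially. dist (a n) l < e)"
    by (auto simp: tendsto_iff)
  have near: "\<exists>\<^sub>F n in sequentially. \<bar>a n - l\<bar> < e / 3"
    unfolding frequently_sequentially
  proof
    fix N
    have "\<forall>\<^sub>F n in sequentially. dist ((a \<circ> r) n) l < e / 3 \<and> n \<ge> N"
      using l e(1) by (intro eventually_conj eventually_ge_at_top tendstoD) (auto simp: o_def)
    from eventually_happens'[OF sequentially_bot this]
    obtain n where "dist ((a \<circ> r) n) l < e / 3" "n \<ge> N" by blast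
    then show "\<exists>n\<ge>N. \<bar>a n - l\<bar> < e / 3"
      using seq_suble[OF r, of n] by (intro exI[of _ "r n"]) (auto simp: dist_real_def)
  qed
  have "\<exists>\<^sub>F n in sequentially. a n \<ge> l + e \<or> a n \<le> l - e"
    using e(2) unfolding not_eventually
    by (rule frequently_elim1) (auto simp: dist_real_def)
  then consider "\<exists>\<^sub>F n in sequentially. a n \<ge> l + e" | "\<exists>\<^sub>F n in sequentially. a n \<le> l - e"
    using frequently_disj_iff by blast
  then show ?thesis
  proof cases
    case 1
    show ?thesis
    proof (rule that[of "l + e / 3" "l + e / 2"])
      show "\<exists>\<^sub>F n in sequentially. a n < l + e / 3"
        using near by (rule frequently_elim1) linarith
      show "\<exists>\<^sub>F n in sequentially. l + e / 2 < a n"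
        using 1 by (rule frequently_elim1) (use e in auto)
    qed (use e in auto)
  next
    case 2
    show ?thesis
    proof (rule that[of "l - e / 2" "l - e / 3"])
      show "\<exists>\<^sub>F n in sequentially. a n > l - e / 3"
        using near by (rule frequently_elim1) linarith
      show "\<exists>\<^sub>F n in sequentially. l - e / 2 > a n"
        using 2 by (rule frequently_elim1) (use e in auto)
    qed (use e in auto)
  qed
qed

context gluing_shift
begin

text \<open>Only nearly periodic: the position of the wrong letter may vary from block to
  block.\<close>

definition repeats :: "nat list \<Rightarrow> (nat \<Rightarrow> nat) \<Rightarrow> bool" where
  "repeats w x \<longleftrightarrow> x \<in> X \<and>
     (\<forall>j. \<exists>p. \<forall>i<length w. i \<noteq> p \<longrightarrow> x (length w * j + i) = w ! i)"

text \<open>Indexing by words makes the family countable, so that a single point can run through all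
  of it. The second branch only ensures membership in \<open>X\<close>.\<close>

definition repeat_point :: "nat list \<Rightarrow> nat \<Rightarrow> nat" where
  "repeat_point w = (if \<exists>x. repeats w x then SOME x. repeats w x else SOME x. x \<in> X)"

lemma repeat_point_mem: 
  assumes "X \<noteq> {}"
  shows "repeat_point w \<in> X"
proof (cases "\<exists>x. repeats w x")
  case True
  then have "repeats w (repeat_point w)"
    unfolding repeat_point_def using someI_ex[OF True] by simp
  then show ?thesis by (simp add: repeats_def)
next
  case False
  then show ?thesis using assms by (simp add: repeat_point_def some_in_eq)
qed

lemma repeats_repeat_point:
  assumes "y \<in> X" "n > 0"
  shows "repeats (map y [0..<n]) (repeat_point (map y [0..<n]))"
proof -
  have "strict_mono (\<lambda>j. n * j)" using assms(2) by (intro strict_monoI) simp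
  then obtain x where "x \<in> X"
      "\<forall>j. \<exists>p. \<forall>i. n * j + i < n * Suc j \<longrightarrow> i \<noteq> p \<longrightarrow> x (n * j + i) = y i"
    using gluing[unfolded gluing_def, rule_format, of "\<lambda>j. n * j" "\<lambda>_. y"] assms(1) by auto
  then have "repeats (map y [0..<n]) x" by (auto simp: repeats_def)
  then have *: "\<exists>x. repeats (map y [0..<n]) x" by (rule exI[of _ x])
  show ?thesis unfolding repeat_point_def using someI_ex[OF *] * by simp
qed

lemma birkhoff_bound:
  assumes "\<And>x. x \<in> X \<Longrightarrow> \<bar>\<phi> x\<bar> \<le> B" "x \<in> X"
  shows "\<bar>S \<phi> n x\<bar> \<le> B * n"
proof -
  have "\<bar>S \<phi> n x\<bar> \<le> (\<Sum>i<n. \<bar>\<phi> ((shift ^^ i) x)\<bar>)"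
    unfolding birkhoff_sum_def by (rule sum_abs)
  also have "\<dots> \<le> (\<Sum>i<n. B)" by (intro sum_mono assms shift_pow_mem)
  finally show ?thesis by (simp add: mult.commute)
qed

text \<open>Take a prefix of \<open>y\<close> at a time \<open>n\<close> where the average is below
  \<open>b\<close>, with \<open>n\<close> so large that the gluing error per block is negligible.
  Then every block has average at most \<open>b + \<gamma> / 2\<close>, and the incomplete last
  block is absorbed for large \<open>m\<close>.\<close>

lemma repeat_point_average_le:
  fixes b \<gamma> :: real
  assumes \<phi>: "tame \<phi>" and y: "y \<in> X" and fr: "\<exists>\<^sub>F n in sequentially. S \<phi> n y < b * n"
    and \<gamma>: "\<gamma> > 0"
  obtains w where "\<forall>\<^sub>F m in sequentially. S \<phi> m (repeat_point w) \<le> (b + \<gamma>) * m"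
proof -
  obtain B where B: "\<And>x. x \<in> X \<Longrightarrow> \<bar>\<phi> x\<bar> \<le> B" using tame_bounded[OF \<phi>] by metis
  obtain L where L: "\<And>x y. x \<in> X \<Longrightarrow> y \<in> X \<Longrightarrow> (\<forall>i<L. x i = y i) \<Longrightarrow> \<bar>\<phi> x - \<phi> y\<bar> \<le> \<gamma> / 4"
    using tame_local[OF \<phi>, of "\<gamma> / 4"] \<gamma> by auto
  have B0: "B \<ge> 0" using B[OF y] by simp
  \<comment> \<open>This makes \<open>4 * B * L\<close>, the error of one wrong letter and of the
    block end, at most \<open>\<gamma> * n / 4\<close>; the local error of \<phi> uses another
    \<open>\<gamma> * n / 4\<close>.\<close>
  obtain N where N: "real N \<ge> 16 * B * L / \<gamma>" using real_arch_simple by blast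
  obtain n where n: "n \<ge> max N 1" "S \<phi> n y < b * n"
    using fr unfolding frequently_sequentially by blast
  then have n0: "n > 0" by simp
  have nBL: "4 * B * L \<le> \<gamma> * n / 4"
  proof -
    have "16 * B * L / \<gamma> \<le> n" using N n(1) by linarith
    then show ?thesis using \<gamma> by (simp add: field_simps)
  qed
  define x where "x = repeat_point (map y [0..<n])"
  have "repeats (map y [0..<n]) x" unfolding x_def using y n0 by (rule repeats_repeat_point)
  then have xX: "x \<in> X" and rep: "\<And>j. \<exists>p. \<forall>i<n. i \<noteq> p \<longrightarrow> x (n * j + i) = y i"
    by (auto simp: repeats_def)
  define c where "c = b + \<gamma> / 2"
  have block: "S \<phi> n ((shift ^^ (n * j)) x) \<le> c * n" for j
  proof -
    obtain p where "\<forall>i<n. i \<noteq> p \<longrightarrow> x (n * j + i) = y i" using rep by blast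
    then have "mism ((shift ^^ (n * j)) x) y n \<le> 1" by (intro mism_le_1[of _ p]) auto
    then have "2 * B * L * (real (mism ((shift ^^ (n * j)) x) y n) + 1) \<le> 2 * B * L * (1 + 1)"
      using B0 by (intro mult_left_mono add_right_mono) auto
    moreover have "\<bar>S \<phi> n ((shift ^^ (n * j)) x) - S \<phi> n y\<bar>
        \<le> \<gamma> / 4 * n + 2 * B * L * (real (mism ((shift ^^ (n * j)) x) y n) + 1)"
      using \<gamma> by (intro birkhoff_diff_le shift_pow_mem xX y B L) auto
    ultimately show ?thesis using n(2) nBL by (simp add: c_def algebra_simps)
  qed
  have blocks: "S \<phi> (n * j) x \<le> c * (n * j)" for j
  proof (induction j)
    case 0
    then show ?case by (simp add: birkhoff_sum_def)
  next
    case (Suc j)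
    have "S \<phi> (n * j + n) x \<le> c * (n * j) + c * n"
      unfolding birkhoff_sum_add using Suc block[of j] by simp
    then show ?case by (simp add: algebra_simps)
  qed
  obtain M where M: "real M \<ge> 2 * n * (B + \<bar>c\<bar>) / \<gamma>" using real_arch_simple by blast
  have "S \<phi> m x \<le> (b + \<gamma>) * m" if m: "m \<ge> M" for m
  proof -
    define j r where "j = m div n" and "r = m mod n"
    have m_eq: "m = n * j + r" and r: "r < n" using n0 by (auto simp: j_def r_def)
    have "S \<phi> m x \<le> c * (n * j) + B * r"
      using blocks[of j] birkhoff_bound[of \<phi> B "(shift ^^ (n * j)) x" r] B shift_pow_mem[OF xX]
      unfolding m_eq birkhoff_sum_add by (smt (verit))
    also have "c * (n * j) = c * m - c * r" unfolding m_eq by (simp add: algebra_simps)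
    also have "c * m - c * r + B * r \<le> c * m + (B + \<bar>c\<bar>) * r"
      using abs_ge_minus_self[of c] mult_right_mono[of "- c" "\<bar>c\<bar>" "real r"] by (simp add: algebra_simps)
    also have "\<dots> \<le> c * m + (B + \<bar>c\<bar>) * n"
      using r B0 by (intro add_left_mono mult_left_mono) auto
    also have "(B + \<bar>c\<bar>) * n \<le> \<gamma> / 2 * m"
    proof -
      have "2 * n * (B + \<bar>c\<bar>) / \<gamma> \<le> m" using M m by linarith
      then show ?thesis using \<gamma> by (simp add: field_simps)
    qed
    finally show ?thesis by (simp add: c_def algebra_simps)
  qed
  then show ?thesis
    unfolding x_def by (intro that) (auto simp: eventually_sequentially)
qed

text \<open>The averages along an irregular orbit oscillate across a gap. The lower level is
  captured by a repeated word of \<phi>, the upper one by a repeated word of the negated function; a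
  loss of a third of the gap on each side leaves a gap.\<close>

lemma separating_repeat_points:
  assumes "\<phi> \<in> C0_hat X d shift"
  obtains w1 w2 and c1 c2 :: real where "c1 < c2"
    "\<forall>\<^sub>F m in sequentially. S \<phi> m (repeat_point w1) \<le> c1 * m"
    "\<forall>\<^sub>F m in sequentially. c2 * m \<le> S \<phi> m (repeat_point w2)"
proof -
  have \<phi>: "tame \<phi>" using assms by (auto simp: C0_hat_def intro: C0_tame)
  obtain y where y: "y \<in> X" "\<not> convergent (\<lambda>n. 1 / real n * S \<phi> n y)"
    using assms by (auto simp: C0_hat_def irregular_set_def)
  obtain B where B: "\<And>x. x \<in> X \<Longrightarrow> \<bar>\<phi> x\<bar> \<le> B" using tame_bounded[OF \<phi>] by metis
  have "\<bar>1 / real n * S \<phi> n y\<bar> \<le> B" for n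
  proof (cases "n = 0")
    case True
    then show ?thesis using B[OF y(1)] by simp
  next
    case False
    then show ?thesis using birkhoff_bound[of \<phi> B y n] B y(1) by (simp add: abs_mult field_simps)
  qed
  then have "bounded (range (\<lambda>n. 1 / real n * S \<phi> n y))"
    by (auto simp: bounded_iff)
  then obtain b1 b2 where b: "b1 < b2"
    "\<exists>\<^sub>F n in sequentially. 1 / real n * S \<phi> n y < b1"
    "\<exists>\<^sub>F n in sequentially. 1 / real n * S \<phi> n y > b2"
    using bounded_oscillation y(2) by blast
  define \<gamma> where "\<gamma> = (b2 - b1) / 3"
  have \<gamma>: "\<gamma> > 0" using b(1) by (simp add: \<gamma>_def)
  have pos: "\<forall>\<^sub>F n in sequentially. n > (0::nat)" by (rule eventually_gt_at_top)
  have "\<exists>\<^sub>F n in sequentially. S \<phi> n y < b1 * n"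
    using frequently_eventually_frequently[OF b(2) pos]
    by (rule frequently_elim1) (auto simp: field_simps)
  then obtain w1 where w1: "\<forall>\<^sub>F m in sequentially. S \<phi> m (repeat_point w1) \<le> (b1 + \<gamma>) * m"
    using repeat_point_average_le[OF \<phi> y(1) _ \<gamma>] by blast
  have "\<exists>\<^sub>F n in sequentially. S (\<lambda>x. - \<phi> x) n y < - b2 * n"
    using frequently_eventually_frequently[OF b(3) pos]
    by (rule frequently_elim1) (auto simp: field_simps birkhoff_uminus)
  then obtain w2 where w2: "\<forall>\<^sub>F m in sequentially. S (\<lambda>x. - \<phi> x) m (repeat_point w2) \<le> (- b2 + \<gamma>) * m"
    using repeat_point_average_le[OF tame_uminus[OF \<phi>] y(1) _ \<gamma>] by blast
  have "\<forall>\<^sub>F m in sequentially. (b2 - \<gamma>) * m \<le> S \<phi> m (repeat_point w2)"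
    using w2 by (rule eventually_mono) (simp add: birkhoff_uminus algebra_simps)
  moreover have "b1 + \<gamma> < b2 - \<gamma>" using b(1) by (simp add: \<gamma>_def field_simps)
  ultimately show ?thesis using w1 that by blast
qed

end

section \<open>Completely irregular points\<close>

text \<open>Enumerating words by the first component of \<open>prod_decode\<close> schedules each
  word in infinitely many windows.\<close>

lemma frequently_prod_decode: "\<exists>\<^sub>F j in sequentially. fst (prod_decode j) = a"
  unfolding frequently_sequentially
proof
  fix N
  show "\<exists>j\<ge>N. fst (prod_decode j) = a"
    by (rule exI[of _ "prod_encode (a, N)"]) (simp add: le_prod_encode_2)
qed

context gluing_shift
begin

lemma near_completely_irregular:
  assumes z: "z \<in> X" and Q: "Q \<ge> (2::nat)"
  obtains x where "x \<in> completely_irregular_set X d shift"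
    "\<And>n. n \<ge> Q \<Longrightarrow> real (mism x z n) \<le> 4 / Q * n"
proof -
  \<comment> \<open>Piece \<open>2j\<close> ends, and the window of piece \<open>2j + 1\<close> begins, at \<open>Q 2\<^sup>j\<close>; the window has length \<open>2\<^sup>j\<close>.\<close>
  define M where "M i = (if i = 0 then 0 else if odd i then Q * 2 ^ (i div 2) else (Q + 1) * 2 ^ (i div 2 - 1))"
    for i :: nat
  have M0: "M 0 = 0" and M1: "M (Suc (2 * j)) = Q * 2 ^ j"
    and M2: "M (Suc (Suc (2 * j))) = Q * 2 ^ j + 2 ^ j" for j
    by (simp_all add: M_def)
  have "M i < M (Suc i)" for i
  proof (cases "even i")
    case True
    then obtain j where "i = 2 * j" by (auto elim: evenE)
    then show ?thesis
    proof (cases j)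
      case (Suc j')
      \<comment> \<open>A window ends before the next one begins, since
        \<open>Q + 1 < 2 * Q\<close>.\<close>
      have "Q * 2 ^ j' + 2 ^ j' < 2 * (Q * 2 ^ j')"
        using Q mult_le_mono1[of 2 Q "2 ^ j'"] zero_less_power[of "2::nat" j'] by linarith
      then show ?thesis using M2[of j'] M1[of j] Suc \<open>i = 2 * j\<close> by simp
    qed (use Q in \<open>simp add: M_def\<close>)
  next
    case False
    then obtain j where "i = Suc (2 * j)" by (auto elim: oddE)
    then show ?thesis using M1[of j] M2[of j] by simp
  qed
  then have M: "strict_mono M" by (simp add: strict_mono_Suc_iff)
  define y where "y j = repeat_point (from_nat (fst (prod_decode j)))" for j
  have y: "y j \<in> X" for j unfolding y_def by (rule repeat_point_mem) (use z in auto)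
  \<comment> \<open>Even pieces copy \<open>z\<close> at its own positions; odd pieces copy a repeat
    point from its beginning.\<close>
  define s where "s i = (if even i then (shift ^^ M i) z else y (i div 2))" for i
  have "\<forall>i. s i \<in> X" using z y shift_pow_mem by (simp add: s_def)
  then obtain x where x: "x \<in> X"
    and xs: "\<And>i. \<exists>p. \<forall>l. M i + l < M (Suc i) \<longrightarrow> l \<noteq> p \<longrightarrow> x (M i + l) = s i l"
    using gluing[unfolded gluing_def, rule_format, OF M M0] by blast
  have piece: "mism ((shift ^^ M i) x) (s i) l \<le> 1" if "M i + l \<le> M (Suc i)" for i l
  proof -
    obtain p where "\<forall>l. M i + l < M (Suc i) \<longrightarrow> l \<noteq> p \<longrightarrow> x (M i + l) = s i l" using xs by blast
    then show ?thesis using that by (intro mism_le_1[of _ p]) auto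
  qed
  \<comment> \<open>The earlier windows have total length \<open>2 ^ j - 1\<close>, all of which may
    be wrong, and the \<open>j + 1\<close> pieces copied from \<open>z\<close> have at most one
    wrong letter each.\<close>
  have free: "mism x z (Q * 2 ^ j) \<le> 2 ^ j + j" for j
  proof (induction j)
    case 0
    have "mism x z Q \<le> 1" using piece[of 0 Q] M1[of 0] by (simp add: M0 s_def)
    then show ?case by simp
  next
    case (Suc j)
    define m where "m = Suc (Suc (2 * j))"
    have m: "M m = Q * 2 ^ j + 2 ^ j" "M (Suc m) = Q * 2 ^ Suc j"
      using M2[of j] M1[of "Suc j"] by (simp_all add: m_def)
    define r where "r = M (Suc m) - M m"
    have r: "M (Suc m) = M m + r" using M by (simp add: r_def strict_mono_less_eq)
    have "mism x z (M (Suc m)) = mism x z (M m) + mism ((shift ^^ M m) x) ((shift ^^ M m) z) r"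
      unfolding r by (rule mism_add)
    also have "mism ((shift ^^ M m) x) ((shift ^^ M m) z) r \<le> 1"
      using piece[of m r] r by (simp add: s_def m_def)
    also have "mism x z (M m) = mism x z (Q * 2 ^ j) + mism ((shift ^^ (Q * 2 ^ j)) x) ((shift ^^ (Q * 2 ^ j)) z) (2 ^ j)"
      unfolding m by (rule mism_add)
    also have "\<dots> \<le> (2 ^ j + j) + 2 ^ j"
      using Suc by (intro add_mono mism_le) auto
    finally show ?case using m by simp
  qed
  have near: "real (mism x z n) \<le> 4 / Q * n" if n: "n \<ge> Q" for n
  proof -
    have "n div Q \<ge> 1" using n Q by (simp add: div_greater_zero_iff Suc_leI)
    \<comment> \<open>This is the dyadic scale with
      \<open>Q * 2 ^ j \<le> n < Q * 2 ^ (j + 1)\<close>. The mismatches are counted up to its upper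
      end and compared with its lower end.\<close>
    then obtain j where j: "2 ^ j \<le> n div Q" "n div Q < 2 ^ (j + 1)"
      using ex_power_ivl1[of 2 "n div Q"] by auto
    have "Q * 2 ^ j \<le> Q * (n div Q)" using j(1) by simp
    also have "\<dots> \<le> n" by simp
    finally have lo: "Q * 2 ^ j \<le> n" .
    have "n \<le> Q * 2 ^ (j + 1)" using j(2) Q by (simp add: div_less_iff_less_mult mult.commute)
    then have "mism x z n \<le> mism x z (Q * 2 ^ (j + 1))" by (rule mism_mono)
    also have "\<dots> \<le> 2 ^ (j + 1) + (j + 1)" by (rule free)
    also have "\<dots> \<le> 4 * 2 ^ j" using less_exp[of "j + 1"] by simp
    finally have "mism x z n \<le> 4 * 2 ^ j" .
    then have "real (mism x z n) \<le> real (4 * 2 ^ j)" by (rule of_nat_mono)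
    also have "\<dots> = 4 / Q * real (Q * 2 ^ j)" using Q by simp
    also have "\<dots> \<le> 4 / Q * n" using lo by (intro mult_left_mono of_nat_mono) auto
    finally show ?thesis .
  qed
  have "x \<in> irregular_set X shift \<phi>" if \<phi>: "\<phi> \<in> C0_hat X d shift" for \<phi>
  proof (rule ccontr)
    assume "x \<notin> irregular_set X shift \<phi>"
    then obtain c where c: "(\<lambda>n. 1 / real n * S \<phi> n x) \<longlonglongrightarrow> c"
      using x by (auto simp: irregular_set_def convergent_def)
    have tame: "tame \<phi>" using \<phi> by (auto simp: C0_hat_def intro: C0_tame)
    obtain B where B: "\<And>x. x \<in> X \<Longrightarrow> \<bar>\<phi> x\<bar> \<le> B" using tame_bounded[OF tame] by metis
    have sub: "(\<lambda>j. 1 / real (K * 2 ^ j) * S \<phi> (K * 2 ^ j) x) \<longlonglongrightarrow> c" if "K > 0" for K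
    proof -
      have "strict_mono (\<lambda>j. K * 2 ^ j)" using that by (intro strict_monoI) simp
      from LIMSEQ_subseq_LIMSEQ[OF c this] show ?thesis by (simp add: o_def)
    qed
    have scale: "real K * (1 / real (K * 2 ^ j) * t) = t / 2 ^ j" if "K > 0" for K j :: nat and t :: real
      using that by simp
    \<comment> \<open>The averages up to the end and up to the start of a window, weighted with
      \<open>Q + 1\<close> and \<open>Q\<close>, differ by exactly the average over the window.
      Hence the window averages converge to \<open>(Q + 1) * c - Q * c = c\<close>.\<close>
    have "(\<lambda>j. real (Q + 1) * (1 / real ((Q + 1) * 2 ^ j) * S \<phi> ((Q + 1) * 2 ^ j) x)
        - real Q * (1 / real (Q * 2 ^ j) * S \<phi> (Q * 2 ^ j) x)) \<longlonglongrightarrow> real (Q + 1) * c - real Q * c"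
      using Q by (intro tendsto_intros sub) auto
    moreover have "real (Q + 1) * (1 / real ((Q + 1) * 2 ^ j) * S \<phi> ((Q + 1) * 2 ^ j) x)
        - real Q * (1 / real (Q * 2 ^ j) * S \<phi> (Q * 2 ^ j) x) = S \<phi> (2 ^ j) ((shift ^^ (Q * 2 ^ j)) x) / 2 ^ j" for j
    proof -
      have "S \<phi> ((Q + 1) * 2 ^ j) x = S \<phi> (Q * 2 ^ j) x + S \<phi> (2 ^ j) ((shift ^^ (Q * 2 ^ j)) x)"
        using birkhoff_sum_add[of shift \<phi> "Q * 2 ^ j" "2 ^ j" x] by (simp add: algebra_simps)
      moreover have "Q > 0" "Q + 1 > 0" using Q by auto
      ultimately show ?thesis by (simp only: scale diff_divide_distrib[symmetric]) simp
    qed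
    ultimately have window: "(\<lambda>j. S \<phi> (2 ^ j) ((shift ^^ (Q * 2 ^ j)) x) / 2 ^ j) \<longlonglongrightarrow> c"
      by (simp only: of_nat_add of_nat_1) (simp add: algebra_simps)
    \<comment> \<open>Every word fills infinitely many windows, so \<open>c\<close> is nearly
      attained by every repeat point. The three thirds of \<gamma> pay for the convergence of window
      averages, for the local error of \<phi>, and for the wrong letter and the window end.\<close>
    have freq: "\<exists>\<^sub>F j in sequentially. \<bar>S \<phi> (2 ^ j) (repeat_point w) - c * 2 ^ j\<bar> \<le> \<gamma> * 2 ^ j"
      if \<gamma>: "\<gamma> > 0" for w \<gamma>
    proof -
      obtain L where L: "\<And>x y. x \<in> X \<Longrightarrow> y \<in> X \<Longrightarrow> (\<forall>i<L. x i = y i) \<Longrightarrow> \<bar>\<phi> x - \<phi> y\<bar> \<le> \<gamma> / 3"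
        using tame_local[OF tame, of "\<gamma> / 3"] \<gamma> by auto
      have B0: "B \<ge> 0" using B[OF x] by simp
      have "\<forall>\<^sub>F j in sequentially. \<bar>S \<phi> (2 ^ j) ((shift ^^ (Q * 2 ^ j)) x) / 2 ^ j - c\<bar> < \<gamma> / 3"
        using tendstoD[OF window, of "\<gamma> / 3"] \<gamma> by (simp only: dist_real_def)
      moreover have "\<forall>\<^sub>F j in sequentially. 4 * B * L \<le> \<gamma> / 3 * 2 ^ j"
      proof -
        obtain N where N: "4 * B * L / (\<gamma> / 3) \<le> real N" using real_arch_simple by blast
        have "4 * B * L / (\<gamma> / 3) \<le> 2 ^ j" if "j \<ge> N" for j
          using N that of_nat_less_two_power[of j, where 'a = real] by linarith
        then have "\<forall>\<^sub>F j in sequentially. 4 * B * L / (\<gamma> / 3) \<le> 2 ^ j"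
          by (rule eventually_sequentiallyI)
        then show ?thesis by (rule eventually_mono) (use \<gamma> in \<open>simp add: field_simps\<close>)
      qed
      ultimately have ev: "\<forall>\<^sub>F j in sequentially. \<bar>S \<phi> (2 ^ j) ((shift ^^ (Q * 2 ^ j)) x) / 2 ^ j - c\<bar> < \<gamma> / 3
          \<and> 4 * B * L \<le> \<gamma> / 3 * 2 ^ j"
        by (rule eventually_conj)
      show ?thesis
        using frequently_eventually_frequently[OF frequently_prod_decode[of "to_nat w"] ev]
      proof (rule frequently_elim1, elim conjE)
        fix j
        assume j: "fst (prod_decode j) = to_nat w"
          "\<bar>S \<phi> (2 ^ j) ((shift ^^ (Q * 2 ^ j)) x) / 2 ^ j - c\<bar> < \<gamma> / 3"
          "4 * B * L \<le> \<gamma> / 3 * 2 ^ j"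
        define u where "u = (shift ^^ (Q * 2 ^ j)) x"
        have yw: "y j = repeat_point w" using j(1) by (simp add: y_def)
        have "mism u (y j) (2 ^ j) \<le> 1"
          using piece[of "Suc (2 * j)" "2 ^ j"] M1[of j] M2[of j] by (simp add: s_def u_def)
        then have "2 * B * L * (real (mism u (y j) (2 ^ j)) + 1) \<le> 2 * B * L * (1 + 1)"
          using B0 by (intro mult_left_mono add_right_mono) auto
        also have "\<dots> \<le> \<gamma> / 3 * 2 ^ j" using j(3) by simp
        finally have "2 * B * L * (real (mism u (y j) (2 ^ j)) + 1) \<le> \<gamma> / 3 * 2 ^ j" .
        moreover have "\<bar>S \<phi> (2 ^ j) u - S \<phi> (2 ^ j) (y j)\<bar>
            \<le> \<gamma> / 3 * (2 ^ j :: nat) + 2 * B * L * (real (mism u (y j) (2 ^ j)) + 1)"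
          unfolding u_def using \<gamma> by (intro birkhoff_diff_le shift_pow_mem x y B L) auto
        moreover have "\<bar>S \<phi> (2 ^ j) u - c * 2 ^ j\<bar> \<le> \<gamma> / 3 * 2 ^ j"
        proof -
          have "\<bar>S \<phi> (2 ^ j) u - c * 2 ^ j\<bar> = \<bar>S \<phi> (2 ^ j) u / 2 ^ j - c\<bar> * 2 ^ j"
            by (simp add: abs_mult[symmetric] field_simps flip: abs_mult)
          also have "\<dots> \<le> \<gamma> / 3 * 2 ^ j"
            using j(2) by (intro mult_right_mono) (auto simp: u_def)
          finally show ?thesis .
        qed
        ultimately show "\<bar>S \<phi> (2 ^ j) (repeat_point w) - c * 2 ^ j\<bar> \<le> \<gamma> * 2 ^ j"
          unfolding yw of_nat_power of_nat_numeral by argo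
      qed
    qed
    obtain w1 w2 and c1 c2 :: real where w: "c1 < c2"
      "\<forall>\<^sub>F m in sequentially. S \<phi> m (repeat_point w1) \<le> c1 * m"
      "\<forall>\<^sub>F m in sequentially. c2 * m \<le> S \<phi> m (repeat_point w2)"
      using separating_repeat_points[OF \<phi>] by metis
    have pow: "strict_mono (\<lambda>j::nat. 2 ^ j :: nat)" by (intro strict_monoI) simp
    \<comment> \<open>Both repeat points must have averages within \<gamma> of \<open>c\<close> at
      some power of two, but the levels \<open>c1\<close> and \<open>c2\<close> are
      \<open>3 * \<gamma>\<close> apart.\<close>
    define \<gamma> where "\<gamma> = (c2 - c1) / 3"
    have \<gamma>: "\<gamma> > 0" using w(1) by (simp add: \<gamma>_def)
    have "\<exists>\<^sub>F j in sequentially. \<bar>S \<phi> (2 ^ j) (repeat_point w1) - c * 2 ^ j\<bar> \<le> \<gamma> * 2 ^ j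
        \<and> S \<phi> (2 ^ j) (repeat_point w1) \<le> c1 * (2 ^ j :: nat)"
      using frequently_eventually_frequently[OF freq[OF \<gamma>] eventually_subseq[OF pow w(2)]] .
    then obtain j where "\<bar>S \<phi> (2 ^ j) (repeat_point w1) - c * 2 ^ j\<bar> \<le> \<gamma> * 2 ^ j"
        "S \<phi> (2 ^ j) (repeat_point w1) \<le> c1 * 2 ^ j"
      using frequently_ex by force
    then have "c * 2 ^ j \<le> (c1 + \<gamma>) * 2 ^ j" by (simp add: algebra_simps)
    then have 1: "c \<le> c1 + \<gamma>" by simp
    have "\<exists>\<^sub>F j in sequentially. \<bar>S \<phi> (2 ^ j) (repeat_point w2) - c * 2 ^ j\<bar> \<le> \<gamma> * 2 ^ j
        \<and> c2 * (2 ^ j :: nat) \<le> S \<phi> (2 ^ j) (repeat_point w2)"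
      using frequently_eventually_frequently[OF freq[OF \<gamma>] eventually_subseq[OF pow w(3)]] .
    then obtain j where "\<bar>S \<phi> (2 ^ j) (repeat_point w2) - c * 2 ^ j\<bar> \<le> \<gamma> * 2 ^ j"
        "c2 * 2 ^ j \<le> S \<phi> (2 ^ j) (repeat_point w2)"
      using frequently_ex by force
    then have "(c2 - \<gamma>) * 2 ^ j \<le> c * 2 ^ j" by (simp add: algebra_simps)
    then have "c2 - \<gamma> \<le> c" by simp
    then show False using 1 w(1) by (simp add: \<gamma>_def field_simps)
  qed
  then have "x \<in> completely_irregular_set X d shift"
    using x by (simp add: completely_irregular_set_def)
  then show ?thesis using near that by blast
qed

end

section \<open>Hamming balls\<close>

text \<open>Chernoff's method: weight each word with \<theta> to the number of its mismatches. Words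
  of the ball have weight at least \<open>\<theta> powr h\<close>, while the total weight of all
  words is a product over positions.\<close>

lemma hamming_ball_card:
  fixes k :: nat and \<theta> :: real
  assumes "0 < \<theta>" "\<theta> \<le> 1" and c: "\<And>i. i < n \<Longrightarrow> c i < k"
  shows "real (card {w \<in> {..<n} \<rightarrow>\<^sub>E {..<k}. real (mism w c n) \<le> h}) * \<theta> powr h \<le> (1 + k * \<theta>) ^ n"
proof -
  define F where "F = {..<n} \<rightarrow>\<^sub>E {..<k}"
  define G where "G = {w \<in> F. real (mism w c n) \<le> h}"
  have fin: "finite F" unfolding F_def by (intro finite_PiE) auto
  have "card G * \<theta> powr h = (\<Sum>w\<in>G. \<theta> powr h)" by simp
  also have "\<dots> \<le> (\<Sum>w\<in>G. \<Prod>i<n. if w i = c i then 1 else \<theta>)"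
  proof (rule sum_mono)
    fix w assume "w \<in> G"
    then have "\<theta> powr h \<le> \<theta> powr mism w c n"
      using assms by (intro powr_mono') (auto simp: G_def)
    also have "\<dots> = \<theta> ^ mism w c n" using assms by (simp add: powr_realpow)
    also have "\<dots> = (\<Prod>i<n. if w i = c i then 1 else \<theta>)"
      by (simp add: prod.If_cases mism_def Int_def)
    finally show "\<theta> powr h \<le> (\<Prod>i<n. if w i = c i then 1 else \<theta>)" .
  qed
  also have "\<dots> \<le> (\<Sum>w\<in>F. \<Prod>i<n. if w i = c i then 1 else \<theta>)"
    using fin assms by (intro sum_mono2 prod_nonneg) (auto simp: G_def)
  also have "\<dots> = (\<Prod>i<n. \<Sum>a<k. if a = c i then 1 else \<theta>)"
    unfolding F_def by (rule prod_sum_PiE[symmetric]) auto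
  also have "\<dots> \<le> (\<Prod>i<n. 1 + k * \<theta>)"
  proof (rule prod_mono, intro conjI)
    fix i assume i: "i \<in> {..<n}"
    show "0 \<le> (\<Sum>a<k. if a = c i then 1 else \<theta>)" using assms by (intro sum_nonneg) auto
    have "(\<Sum>a<k. if a = c i then 1 else \<theta>) \<le> (\<Sum>a<k. (if a = c i then 1 else 0) + \<theta>)"
      using assms by (intro sum_mono) auto
    also have "\<dots> = 1 + k * \<theta>" using c i by (simp add: sum.distrib)
    finally show "(\<Sum>a<k. if a = c i then 1 else \<theta>) \<le> 1 + k * \<theta>" .
  qed
  finally show ?thesis by (simp add: G_def F_def)
qed

lemma hamming_ball_card_exp:
  assumes "\<delta> > 0"
  obtains \<alpha> where "\<alpha> > 0" "\<And>n c. (\<And>i. i < n \<Longrightarrow> c i < k) \<Longrightarrow>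
    real (card {w \<in> {..<n} \<rightarrow>\<^sub>E {..<k}. real (mism w c n) \<le> \<alpha> * n}) \<le> 2 powr (\<delta> * n)"
proof -
  define q :: real where "q = 2 powr (\<delta> / 2)"
  have q: "q > 1" using powr_less_mono[of 0 "\<delta> / 2" 2] assms by (simp add: q_def)
  \<comment> \<open>Small enough for \<open>1 + k * \<theta> \<le> q\<close>. The bound 1/2 keeps
    the logarithm below positive, and \<open>k + 1\<close> keeps the denominator nonzero.\<close>
  define \<theta> where "\<theta> = min (1/2) ((q - 1) / (k + 1))"
  have \<theta>: "0 < \<theta>" "\<theta> < 1" using q by (auto simp: \<theta>_def)
  have "k * \<theta> \<le> k * ((q - 1) / (k + 1))" unfolding \<theta>_def by (intro mult_left_mono) auto
  also have "\<dots> \<le> q - 1" using q by (simp add: field_simps)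
  finally have 1: "1 + k * \<theta> \<le> q" by simp
  \<comment> \<open>The solution of
    \<open>\<theta> powr (\<alpha> * n) = 2 powr (- \<delta> / 2 * n)\<close>: half of \<delta> is
    spent here, half on \<open>q ^ n\<close>.\<close>
  define \<alpha> where "\<alpha> = \<delta> / 2 / log 2 (1 / \<theta>)"
  have lg: "log 2 (1 / \<theta>) > 0" using \<theta> by simp
  have \<alpha>: "\<alpha> > 0" using lg assms by (simp add: \<alpha>_def)
  have \<theta>_eq: "\<theta> = 2 powr (- log 2 (1 / \<theta>))" using \<theta> by (simp add: powr_minus log_divide)
  then have \<theta>\<alpha>: "\<theta> powr (\<alpha> * n) = 2 powr (- (\<delta> / 2) * n)" for n :: nat
  proof -
    have "\<theta> powr (\<alpha> * n) = (2 powr (- log 2 (1 / \<theta>))) powr (\<alpha> * n)" using \<theta>_eq by simp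
    also have "\<dots> = 2 powr (- log 2 (1 / \<theta>) * (\<alpha> * n))" by (rule powr_powr)
    also have "- log 2 (1 / \<theta>) * (\<alpha> * n) = - (\<delta> / 2) * n" using lg by (simp add: \<alpha>_def)
    finally show ?thesis .
  qed
  show ?thesis
  proof (rule that[OF \<alpha>])
    fix n and c :: "nat \<Rightarrow> nat" assume "\<And>i. i < n \<Longrightarrow> c i < k"
    then have "real (card {w \<in> {..<n} \<rightarrow>\<^sub>E {..<k}. real (mism w c n) \<le> \<alpha> * n}) * \<theta> powr (\<alpha> * n) \<le> (1 + k * \<theta>) ^ n"
      using \<theta> by (intro hamming_ball_card) auto
    also have "\<dots> \<le> q ^ n" using 1 \<theta> by (intro power_mono) auto
    also have "\<dots> = 2 powr (\<delta> / 2 * n)" by (simp add: q_def powr_power mult.commute)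
    finally have "real (card {w \<in> {..<n} \<rightarrow>\<^sub>E {..<k}. real (mism w c n) \<le> \<alpha> * n}) \<le> 2 powr (\<delta> / 2 * n) * 2 powr (\<delta> / 2 * n)"
      unfolding \<theta>\<alpha> by (simp add: powr_minus field_simps)
    also have "\<dots> = 2 powr (\<delta> * n)" by (simp add: powr_add[symmetric] field_simps)
    finally show "real (card {w \<in> {..<n} \<rightarrow>\<^sub>E {..<k}. real (mism w c n) \<le> \<alpha> * n}) \<le> 2 powr (\<delta> * n)" .
  qed
qed

section \<open>Subadditivity of extended nonnegative sums\<close>

lemma ennreal_summable_on: "f summable_on A" for f :: "'a \<Rightarrow> ennreal"
  by (simp add: nonneg_summable_on_complete)

lemma sum_UNION_le_ennreal:
  fixes f :: "'b \<Rightarrow> ennreal"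
  assumes "finite C" "\<And>c. c \<in> C \<Longrightarrow> finite (F c)"
  shows "sum f (\<Union>c\<in>C. F c) \<le> (\<Sum>c\<in>C. sum f (F c))"
  using assms
proof (induction C)
  case (insert c C)
  have "sum f (F c \<union> (\<Union>c\<in>C. F c)) \<le> sum f (F c \<union> (\<Union>c\<in>C. F c)) + sum f (F c \<inter> (\<Union>c\<in>C. F c))"
    by simp
  also have "\<dots> = sum f (F c) + sum f (\<Union>c\<in>C. F c)"
    using insert by (intro sum.union_inter) auto
  also have "\<dots> \<le> sum f (F c) + (\<Sum>c\<in>C. sum f (F c))"
    using insert by (intro add_left_mono) auto
  finally show ?case using insert by simp
qed simp

text \<open>The sets \<open>F c\<close> may overlap, which only decreases the sum over the union.
  With singletons this also handles the image of a map that need not be injective.\<close>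

lemma infsum_UNION_le_ennreal:
  fixes f :: "'b \<Rightarrow> ennreal" and g :: "'a \<Rightarrow> ennreal"
  assumes fin: "\<And>c. c \<in> A \<Longrightarrow> finite (F c)" and le: "\<And>c. c \<in> A \<Longrightarrow> sum f (F c) \<le> g c"
  shows "infsum f (\<Union>c\<in>A. F c) \<le> infsum g A"
proof (rule infsum_le_finite_sums)
  fix T assume T: "finite T" "T \<subseteq> (\<Union>c\<in>A. F c)"
  then obtain C where C: "C \<subseteq> A" "finite C" "T \<subseteq> (\<Union>c\<in>C. F c)"
    by (metis finite_subset_Union finite_subset_image) 
  have "sum f T \<le> sum f (\<Union>c\<in>C. F c)"
    using C fin by (intro sum_mono2) auto
  also have "\<dots> \<le> (\<Sum>c\<in>C. sum f (F c))"
    using C fin by (intro sum_UNION_le_ennreal) auto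
  also have "\<dots> \<le> sum g C" using C le by (intro sum_mono) auto
  also have "\<dots> \<le> infsum g A"
  proof -
    have "infsum g C \<le> infsum g A" 
      by (rule infsum_mono_neutral) (use C in \<open>auto simp: ennreal_summable_on\<close>)
    then show ?thesis using C by simp
  qed
  finally show "sum f T \<le> infsum g A" .
qed (rule ennreal_summable_on)

section \<open>Transfer of covers\<close>

text \<open>A common form of \<open>pressure_C_n\<close> and \<open>BS_N_n\<close>; the free weight
  also allows the powers of \<beta> that describe Hausdorff measure.\<close>

definition cover_inf ::
  "'a set \<Rightarrow> ('a \<Rightarrow> 'a \<Rightarrow> real) \<Rightarrow> ('a \<Rightarrow> 'a) \<Rightarrow> 'a set \<Rightarrow> real \<Rightarrow> ('a \<Rightarrow> nat \<Rightarrow> real) \<Rightarrow> nat \<Rightarrow> ennreal" where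
  "cover_inf X d f E \<epsilon> w n = (INF \<C>\<in>bowen_covers X d f n E \<epsilon>. \<Sum>\<^sub>\<infinity>(x, m)\<in>\<C>. ennreal (w x m))"

lemma cover_inf_mono: "n \<le> n' \<Longrightarrow> E \<subseteq> E' \<Longrightarrow> cover_inf X d f E \<epsilon> w n \<le> cover_inf X d f E' \<epsilon> w n'"
  unfolding cover_inf_def by (intro INF_superset_mono) (auto simp: bowen_covers_def)

lemma lim_incseq_eq_0_iff:
  fixes f :: "nat \<Rightarrow> ennreal"
  assumes "incseq f"
  shows "lim f = 0 \<longleftrightarrow> (\<forall>n. f n = 0)"
proof -
  have "lim f = (SUP n. f n)" using LIMSEQ_SUP[OF assms] by (rule limI)
  moreover have "(SUP n. f n) = 0 \<longleftrightarrow> (\<forall>n. f n = 0)" by (simp flip: bot_ennreal)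
  ultimately show ?thesis by simp
qed

lemma lim_cover_inf_eq_0_iff:
  "lim (cover_inf X d f E \<epsilon> w) = 0 \<longleftrightarrow> (\<forall>n. cover_inf X d f E \<epsilon> w n = 0)"
  by (rule lim_incseq_eq_0_iff) (auto intro!: incseq_SucI cover_inf_mono)

text \<open>An arbitrarily small increase of the exponent is permitted; this is the room in which
  the factors \<open>2 powr (\<delta> * m)\<close> are absorbed.\<close>

lemma Inf_ereal_eqI:
  assumes "A \<subseteq> B" "\<And>t \<delta>::real. t \<in> B \<Longrightarrow> \<delta> > 0 \<Longrightarrow> t + \<delta> \<in> A"
  shows "Inf (ereal ` B) = Inf (ereal ` A)"
proof (rule antisym)
  show "Inf (ereal ` B) \<le> Inf (ereal ` A)" using assms(1) by (intro Inf_superset_mono) auto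
  show "Inf (ereal ` A) \<le> Inf (ereal ` B)"
  proof (rule Inf_greatest)
    fix u assume "u \<in> ereal ` B"
    then obtain t where t: "t \<in> B" "u = ereal t" by auto
    show "Inf (ereal ` A) \<le> u"
    proof (rule ereal_le_epsilon2)
      fix e :: real assume "e > 0"
      then have "t + e \<in> A" using t assms(2) by blast
      then have "Inf (ereal ` A) \<le> ereal (t + e)" by (intro Inf_lower imageI)
      then show "Inf (ereal ` A) \<le> u + ereal e" using t by simp
    qed
  qed
qed

context gluing_shift
begin

abbreviation CI :: "(nat \<Rightarrow> nat) set" where
  "CI \<equiv> completely_irregular_set X d shift"

definition scale :: "real \<Rightarrow> nat \<Rightarrow> bool" where
  "scale \<epsilon> r \<longleftrightarrow> (\<forall>x y. d x y \<le> \<epsilon> \<longleftrightarrow> (\<forall>i<Suc r. x i = y i))"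

lemma scale_ex:
  assumes "0 < \<epsilon>" "\<epsilon> < 1"
  obtains r where "scale \<epsilon> r"
  using beta_dist_le_scale[OF beta_gt_1 assms] unfolding scale_def by metis

text \<open>At this scale there is no excess: a Bowen ball of length \<open>m\<close> is a cylinder
  of length \<open>m\<close>, whose diameter is at most \<open>1 / \<beta> ^ m\<close>.\<close>

lemma scale_inverse: "scale (1 / \<beta>) 0"
  using beta_dist_le_power[OF beta_gt_1, of _ _ 1] by (simp add: scale_def)

text \<open>The \<open>m\<close> windows of length \<open>Suc r\<close> together cover the positions
  below \<open>m + r\<close>.\<close>

lemma bowen_ball_eq:
  assumes "scale \<epsilon> r" "m > 0"
  shows "bowen_ball X d shift m x \<epsilon> = {y \<in> X. \<forall>i<m + r. x i = y i}"
proof -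
  have "(\<forall>j<m. \<forall>i<Suc r. x (j + i) = y (j + i)) \<longleftrightarrow> (\<forall>i<m + r. x i = y i)" (is "?L \<longleftrightarrow> ?R") for y
  proof
    assume L: ?L
    show ?R
    proof (intro allI impI)
      fix i assume i: "i < m + r"
      define j where "j = min i (m - 1)"
      have "j < m" "i - j < Suc r" "j + (i - j) = i" using i assms(2) by (auto simp: j_def)
      then show "x i = y i" using L by metis
    qed
  qed auto
  then show ?thesis using assms(1) unfolding scale_def bowen_ball_def by simp
qed

lemma bowen_ball_self: "scale \<epsilon> r \<Longrightarrow> x \<in> X \<Longrightarrow> x \<in> bowen_ball X d shift m x \<epsilon>"
  unfolding scale_def bowen_ball_def by simp

lemma bowen_ball_subset: "bowen_ball X d shift m x \<epsilon> \<subseteq> X"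
  by (auto simp: bowen_ball_def)

text \<open>Each point of \<open>X\<close> agrees with a completely irregular point up to a small proportion of letters,
  so replacing each ball of a cover of \<open>CI\<close> by the balls whose words lie in a small Hamming ball
  around its word gives a cover of \<open>X\<close>. A ball of length \<open>m\<close> is replaced by at most \<open>2\<^sup>\<delta>\<^sup>m\<close> balls.\<close>

lemma cover_inf_transfer:
  assumes sc: "scale \<epsilon> r" and \<delta>: "\<delta> > (0::real)" and \<alpha>: "\<alpha> > (0::real)"
    and w0: "\<And>x m. 0 \<le> w x m"
    and w: "\<And>x z m. m \<ge> N \<Longrightarrow> x \<in> X \<Longrightarrow> z \<in> X \<Longrightarrow> real (mism x z m) \<le> \<alpha> * m \<Longrightarrow>
       w' z m * 2 powr (\<delta> * m) \<le> w x m"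
    and zero: "\<And>n. cover_inf X d shift CI \<epsilon> w n = 0"
  shows "cover_inf X d shift X \<epsilon> w' n = 0"
proof -
  \<comment> \<open>Words have length \<open>m + r\<close>, which is at most \<open>2 * m\<close>
    for the lengths in use. Halving \<delta> here and \<alpha> in the next definition compensates
    for that.\<close>
  obtain \<alpha>1 :: real where \<alpha>1: "\<alpha>1 > 0" "\<And>n c. (\<And>i. i < n \<Longrightarrow> c i < k) \<Longrightarrow>
    real (card {w \<in> {..<n} \<rightarrow>\<^sub>E {..<k}. real (mism w c n) \<le> \<alpha>1 * n}) \<le> 2 powr (\<delta> / 2 * n)"
    by (rule hamming_ball_card_exp[of "\<delta> / 2" k]) (use \<delta> in auto)
  define \<alpha>2 where "\<alpha>2 = min \<alpha>1 (\<alpha> / 2)"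
  have \<alpha>2: "\<alpha>2 > 0" "\<alpha>2 \<le> \<alpha>1" "\<alpha>2 \<le> \<alpha> / 2" using \<alpha> \<alpha>1 by (auto simp: \<alpha>2_def)
  obtain Q0 where Q0: "real Q0 \<ge> 4 / \<alpha>2" using real_arch_simple by blast
  define Q where "Q = max Q0 2"
  have Q: "Q \<ge> 2" "4 / Q \<le> \<alpha>2"
  proof -
    have "real Q \<ge> 4 / \<alpha>2" using Q0 by (simp add: Q_def)
    then show "4 / Q \<le> \<alpha>2" using \<alpha>2 by (simp add: Q_def field_simps)
  qed (simp add: Q_def)
  \<comment> \<open>Lengths must be at least \<open>n\<close> for the new cover, \<open>N\<close>
    for the weight comparison, \<open>r\<close> for \<open>m + r \<le> 2 * m\<close>,
    \<open>Q\<close> for the approximation by completely irregular points, and 1 for Bowen balls to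
    be cylinders.\<close>
  define n' where "n' = Max {n, N, r, Q, 1}"
  have n': "n' \<ge> n" "n' \<ge> N" "n' \<ge> r" "n' \<ge> Q" "n' \<ge> 1" by (auto simp: n'_def)
  have "cover_inf X d shift X \<epsilon> w' n \<le> cover_inf X d shift CI \<epsilon> w n'"
    unfolding cover_inf_def[of _ _ _ CI]
  proof (rule INF_greatest)
    fix \<C> assume \<C>: "\<C> \<in> bowen_covers X d shift n' CI \<epsilon>"
    then have \<C>X: "\<And>x m. (x, m) \<in> \<C> \<Longrightarrow> x \<in> X \<and> m \<ge> n'" and "countable \<C>"
      by (auto simp: bowen_covers_def)
    define W where "W x l = {v \<in> {..<l} \<rightarrow>\<^sub>E {..<k}. real (mism v x l) \<le> \<alpha>2 * l \<and> (\<exists>y\<in>X. \<forall>i<l. y i = v i)}"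
      for x l
    \<comment> \<open>Centres of balls must lie in \<open>X\<close>, so each admissible word is
      represented by a point of \<open>X\<close> with this prefix.\<close>
    define rep where "rep v l = (SOME y. y \<in> X \<and> (\<forall>i<l. y i = v i))" for v :: "nat \<Rightarrow> nat" and l :: nat
    have rep: "rep v l \<in> X \<and> (\<forall>i<l. rep v l i = v i)" if "v \<in> W x l" for v x l
    proof -
      have "\<exists>y. y \<in> X \<and> (\<forall>i<l. y i = v i)" using that by (auto simp: W_def)
      then show ?thesis unfolding rep_def by (rule someI_ex)
    qed
    have finW: "finite (W x l)" for x l
      unfolding W_def by (rule finite_subset[of _ "{..<l} \<rightarrow>\<^sub>E {..<k}"]) (auto intro: finite_PiE)
    define Z where "Z x m = (\<lambda>v. rep v (m + r)) ` W x (m + r)" for x m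
    have finZ: "finite (Z x m)" for x m using finW by (simp add: Z_def)
    have Z: "y \<in> X \<and> real (mism x y m) \<le> \<alpha> * m" if yZ: "y \<in> Z x m" and mr: "m \<ge> r" for x y m
    proof -
      obtain v where v: "v \<in> W x (m + r)" "y = rep v (m + r)" using yZ unfolding Z_def by blast
      have "mism x y m \<le> mism x y (m + r)" by (rule mism_mono) simp
      also have "mism x y (m + r) = mism v x (m + r)"
        using rep[OF v(1)] v(2) by (subst mism_commute) (auto intro: mism_cong)
      finally have "real (mism x y m) \<le> real (mism v x (m + r))" by (rule of_nat_mono)
      also have "\<dots> \<le> \<alpha>2 * real (m + r)" using v by (simp add: W_def)
      also have "\<dots> \<le> \<alpha> / 2 * real (m + m)"
        using \<alpha>2 \<alpha> mr by (intro mult_mono of_nat_mono) auto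
      finally show ?thesis using rep[OF v(1)] v(2) by simp
    qed
    have cardZ: "real (card (Z x m)) \<le> 2 powr (\<delta> * m)" if "x \<in> X" "m \<ge> r" for x m
    proof -
      have "card (Z x m) \<le> card (W x (m + r))" unfolding Z_def by (rule card_image_le[OF finW])
      also have "\<dots> \<le> card {v \<in> {..<m + r} \<rightarrow>\<^sub>E {..<k}. real (mism v x (m + r)) \<le> \<alpha>1 * real (m + r)}"
      proof (rule card_mono)
        show "finite {v \<in> {..<m + r} \<rightarrow>\<^sub>E {..<k}. real (mism v x (m + r)) \<le> \<alpha>1 * real (m + r)}"
          by (rule finite_subset[of _ "{..<m + r} \<rightarrow>\<^sub>E {..<k}"]) (auto intro: finite_PiE)
        have "\<alpha>2 * real (m + r) \<le> \<alpha>1 * real (m + r)" using \<alpha>2 by (intro mult_right_mono) auto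
        then show "W x (m + r) \<subseteq> {v \<in> {..<m + r} \<rightarrow>\<^sub>E {..<k}. real (mism v x (m + r)) \<le> \<alpha>1 * real (m + r)}"
          unfolding W_def by auto
      qed
      finally have "real (card (Z x m)) \<le>
          real (card {v \<in> {..<m + r} \<rightarrow>\<^sub>E {..<k}. real (mism v x (m + r)) \<le> \<alpha>1 * real (m + r)})"
        by (rule of_nat_mono)
      also have "\<dots> \<le> 2 powr (\<delta> / 2 * real (m + r))"
        by (rule \<alpha>1(2)) (use alphabet that(1) in auto)
      also have "\<dots> \<le> 2 powr (\<delta> * m)"
      proof (rule powr_mono)
        have "\<delta> / 2 * real (m + r) \<le> \<delta> / 2 * real (m + m)"
          using \<delta> that(2) by (intro mult_left_mono of_nat_mono) auto
        then show "\<delta> / 2 * real (m + r) \<le> \<delta> * m" by simp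
      qed simp
      finally show ?thesis .
    qed
    define F where "F c = (case c of (x, m) \<Rightarrow> Z x m \<times> {m})" for c
    define \<C>' where "\<C>' = (\<Union>c\<in>\<C>. F c)"
    have "\<C>' \<in> bowen_covers X d shift n X \<epsilon>"
      unfolding bowen_covers_def
    proof (intro CollectI conjI)
      show "countable \<C>'"
        unfolding \<C>'_def F_def using \<open>countable \<C>\<close> finZ
        by (intro countable_UN) (auto intro!: countable_finite)
      show "\<C>' \<subseteq> X \<times> {n..}"
        unfolding \<C>'_def F_def using \<C>X Z n' by fastforce
      show "X \<subseteq> (\<Union>(x, m)\<in>\<C>'. bowen_ball X d shift m x \<epsilon>)"
      proof
        fix z assume z: "z \<in> X"
        obtain u where u: "u \<in> CI" "\<And>n. n \<ge> Q \<Longrightarrow> real (mism u z n) \<le> 4 / Q * n"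
          using near_completely_irregular[OF z Q(1)] by metis
        obtain x m where xm: "(x, m) \<in> \<C>" "u \<in> bowen_ball X d shift m x \<epsilon>"
          using \<C> u(1) by (auto simp: bowen_covers_def)
        have m: "x \<in> X" "m \<ge> n'" "m > 0" using \<C>X[OF xm(1)] n' by auto
        have ux: "\<forall>i<m + r. x i = u i" using xm(2) bowen_ball_eq[OF sc m(3)] by simp
        define v where "v = restrict z {..<m + r}"
        \<comment> \<open>On the whole cylinder \<open>x\<close> agrees with \<open>u\<close>, so
          the word of \<open>z\<close> is as close to \<open>x\<close> as \<open>z\<close> is to its
          completely irregular approximation \<open>u\<close>.\<close>
        have "mism v x (m + r) = mism u z (m + r)"
          using ux by (subst mism_commute) (auto intro!: mism_cong simp: v_def)
        also have "real (mism u z (m + r)) \<le> 4 / Q * real (m + r)" using m n' by (intro u) auto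
        also have "\<dots> \<le> \<alpha>2 * real (m + r)" using Q by (intro mult_right_mono) auto
        finally have "v \<in> W x (m + r)"
          using z alphabet by (auto simp: W_def v_def intro!: bexI[of _ z])
        then have "rep v (m + r) \<in> Z x m" "\<forall>i<m + r. rep v (m + r) i = z i"
          using rep[of v x "m + r"] by (auto simp: Z_def v_def)
        then have "(rep v (m + r), m) \<in> \<C>'" "z \<in> bowen_ball X d shift m (rep v (m + r)) \<epsilon>"
          using xm(1) z bowen_ball_eq[OF sc m(3)] by (auto simp: \<C>'_def F_def)
        then show "z \<in> (\<Union>(x, m)\<in>\<C>'. bowen_ball X d shift m x \<epsilon>)" by blast
      qed
    qed
    then have "cover_inf X d shift X \<epsilon> w' n \<le> (\<Sum>\<^sub>\<infinity>(x, m)\<in>\<C>'. ennreal (w' x m))"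
      unfolding cover_inf_def by (rule INF_lower)
    also have "\<dots> \<le> (\<Sum>\<^sub>\<infinity>(x, m)\<in>\<C>. ennreal (w x m))"
      unfolding \<C>'_def
    proof (rule infsum_UNION_le_ennreal)
      fix c assume "c \<in> \<C>"
      obtain x m where c: "c = (x, m)" by (cases c)
      have xm: "x \<in> X" "m \<ge> n'" using \<open>c \<in> \<C>\<close> \<C>X c by auto
      then have m: "m \<ge> r" "m \<ge> N" using n' by auto
      show "finite (F c)" using finZ by (simp add: F_def c)
      have "(\<Sum>(y, m)\<in>F c. ennreal (w' y m)) = (\<Sum>y\<in>Z x m. ennreal (w' y m))"
        by (simp add: F_def c sum.cartesian_product[symmetric])
      \<comment> \<open>Each new ball carries at most the old weight divided by
        \<open>2 powr (\<delta> * m)\<close>, and there are at most that many new balls.\<close>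
      also have "\<dots> \<le> (\<Sum>y\<in>Z x m. ennreal (w x m / 2 powr (\<delta> * m)))"
      proof (intro sum_mono ennreal_leI)
        fix y assume "y \<in> Z x m"
        then have "w' y m * 2 powr (\<delta> * m) \<le> w x m" using Z m xm by (intro w) auto
        then show "w' y m \<le> w x m / 2 powr (\<delta> * m)" by (simp add: field_simps)
      qed
      also have "\<dots> = ennreal (real (card (Z x m)) * (w x m / 2 powr (\<delta> * m)))"
        unfolding sum_constant using w0
        by (subst ennreal_mult) (simp_all add: ennreal_of_nat_eq_real_of_nat)
      also have "\<dots> \<le> ennreal (2 powr (\<delta> * m) * (w x m / 2 powr (\<delta> * m)))"
        using w0 cardZ[OF xm(1) m(1)] by (intro ennreal_leI mult_right_mono) auto
      finally show "(\<Sum>(y, m)\<in>F c. ennreal (w' y m)) \<le> (case c of (x, m) \<Rightarrow> ennreal (w x m))"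
        by (simp add: c)
    qed
    finally show "cover_inf X d shift X \<epsilon> w' n \<le> (\<Sum>\<^sub>\<infinity>(x, m)\<in>\<C>. ennreal (w x m))" .
  qed
  then show ?thesis using zero by simp
qed

text \<open>A point \<open>y\<close> of the ball around \<open>z\<close> shares its first
  \<open>m\<close> letters with \<open>z\<close>, so its mismatches with \<open>x\<close> are those
  of \<open>z\<close>. The Birkhoff sum of \<open>y\<close> can thus be compared with that of
  \<open>x\<close>, which lies in its own ball.\<close>

lemma SUP_birkhoff_le:
  fixes \<kappa> :: real
  assumes \<phi>: "tame \<phi>" and sc: "scale \<epsilon> r" and \<kappa>: "\<kappa> > 0"
  obtains \<alpha> :: real and N where "\<alpha> > 0" "\<And>x z m. m \<ge> N \<Longrightarrow> x \<in> X \<Longrightarrow> z \<in> X \<Longrightarrow> real (mism x z m) \<le> \<alpha> * m \<Longrightarrow>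
    (SUP y\<in>bowen_ball X d shift m z \<epsilon>. S \<phi> m y) \<le> (SUP y\<in>bowen_ball X d shift m x \<epsilon>. S \<phi> m y) + \<kappa> * m"
proof -
  obtain B0 where B0: "\<And>x. x \<in> X \<Longrightarrow> \<bar>\<phi> x\<bar> \<le> B0" using tame_bounded[OF \<phi>] by metis
  define B where "B = \<bar>B0\<bar> + 1"
  have B: "\<bar>\<phi> x\<bar> \<le> B" if "x \<in> X" for x using B0[OF that] by (simp add: B_def)
  have Bpos: "B > 0" by (simp add: B_def)
  obtain L where L: "\<And>x y. x \<in> X \<Longrightarrow> y \<in> X \<Longrightarrow> (\<forall>i<L. x i = y i) \<Longrightarrow> \<bar>\<phi> x - \<phi> y\<bar> \<le> \<kappa> / 2"
    using tame_local[OF \<phi>, of "\<kappa> / 2"] \<kappa> by auto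
  define D where "D = 2 * B * (real L + 1)"
  have D: "D > 0" "2 * B * L \<le> D" using Bpos by (auto simp: D_def)
  \<comment> \<open>The error is split as \<kappa>/2 for the local variation, \<kappa>/4 for the
    mismatches and \<kappa>/4 for the end of the word.\<close>
  define \<alpha> where "\<alpha> = \<kappa> / (4 * D)"
  have \<alpha>: "\<alpha> > 0" using \<kappa> D by (simp add: \<alpha>_def)
  obtain N where N: "real N \<ge> 4 * D / \<kappa>" using real_arch_simple by blast
  show ?thesis
  proof (rule that[of \<alpha> "max N 1"])
    fix x z m assume m: "m \<ge> max N 1" and x: "x \<in> X" and z: "z \<in> X" and mis: "real (mism x z m) \<le> \<alpha> * m"
    have bdd: "bdd_above (S \<phi> m ` bowen_ball X d shift m x \<epsilon>)"
      using birkhoff_bound[of \<phi> B _ m] B bowen_ball_subset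
      by (intro bdd_aboveI2[where M = "B * m"]) (meson abs_le_D1 subsetD)
    show "(SUP y\<in>bowen_ball X d shift m z \<epsilon>. S \<phi> m y) \<le> (SUP y\<in>bowen_ball X d shift m x \<epsilon>. S \<phi> m y) + \<kappa> * m"
    proof (rule cSUP_least)
      show "bowen_ball X d shift m z \<epsilon> \<noteq> {}" using bowen_ball_self[OF sc z] by blast
      fix y assume y: "y \<in> bowen_ball X d shift m z \<epsilon>"
      have yX: "y \<in> X" and yz: "\<forall>i<m + r. z i = y i"
        using y bowen_ball_eq[OF sc, of m z] m by auto
      have "mism y x m = mism x z m" using yz by (subst mism_commute) (auto intro: mism_cong)
      then have mis': "real (mism y x m) + 1 \<le> \<alpha> * m + 1" using mis by simp
      have "\<bar>S \<phi> m y - S \<phi> m x\<bar> \<le> \<kappa> / 2 * m + 2 * B * L * (real (mism y x m) + 1)"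
        using \<kappa> by (intro birkhoff_diff_le yX x B L) auto
      also have "2 * B * L * (real (mism y x m) + 1) \<le> D * (\<alpha> * m + 1)"
        using mis' D by (intro mult_mono) auto
      also have "D * (\<alpha> * m + 1) = \<kappa> / 4 * m + D" using D by (simp add: \<alpha>_def field_simps)
      also have "D \<le> \<kappa> / 4 * m"
      proof -
        have "4 * D / \<kappa> \<le> m" using N m by linarith
        then show ?thesis using \<kappa> by (simp add: field_simps)
      qed
      finally have "S \<phi> m y \<le> S \<phi> m x + \<kappa> * m" by (simp add: field_simps)
      also have "S \<phi> m x \<le> (SUP y\<in>bowen_ball X d shift m x \<epsilon>. S \<phi> m y)"
        using bdd bowen_ball_self[OF sc x] by (intro cSUP_upper)
      finally show "S \<phi> m y \<le> (SUP y\<in>bowen_ball X d shift m x \<epsilon>. S \<phi> m y) + \<kappa> * m" by simp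
    qed
  qed (rule \<alpha>)
qed

end

section \<open>Critical exponents\<close>

lemma sum_half_powers_le: "finite I \<Longrightarrow> (\<Sum>i\<in>I. (1 / 2 :: real) ^ Suc i) \<le> 1"
proof -
  assume I: "finite I"
  have "(\<Sum>i<N. (1 / 2 :: real) ^ Suc i) = 1 - (1 / 2) ^ N" for N
    by (induction N) auto
  moreover have "(\<Sum>i\<in>I. (1 / 2 :: real) ^ Suc i) \<le> (\<Sum>i<Suc (Max I). (1 / 2) ^ Suc i)"
    using I by (intro sum_mono2) (auto simp: less_Suc_eq_le)
  ultimately show ?thesis by (smt (verit) zero_le_power zero_le_divide_1_iff)
qed

text \<open>By monotonicity the limit at 0 is the supremum over all positive arguments.\<close>

lemma Lim_at_right_0_antimono_eq_0_iff:
  fixes g :: "real \<Rightarrow> ennreal"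
  assumes "\<And>a b. 0 < a \<Longrightarrow> a \<le> b \<Longrightarrow> g b \<le> g a"
  shows "Lim (at_right 0) g = 0 \<longleftrightarrow> (\<forall>a>0. g a = 0)"
proof -
  define s where "s = (SUP a\<in>{0<..}. g a)"
  have "(g \<longlongrightarrow> s) (at_right 0)"
  proof (rule order_tendstoI)
    fix a assume "a < s"
    then obtain b where b: "b > 0" "a < g b" by (auto simp: s_def less_SUP_iff)
    have "\<forall>\<^sub>F x in at_right 0. x \<in> {0<..<b}" using b(1) by (rule eventually_at_right_real)
    then show "\<forall>\<^sub>F x in at_right 0. a < g x"
      by (rule eventually_mono) (use b assms in \<open>force intro: less_le_trans\<close>)
  next
    fix a assume "s < a"
    moreover have "g x \<le> s" if "x > 0" for x using that by (auto simp: s_def intro: SUP_upper)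
    moreover have "\<forall>\<^sub>F x in at_right (0::real). x > 0" by (rule eventually_at_right_less)
    ultimately show "\<forall>\<^sub>F x in at_right 0. g x < a" by (auto elim!: eventually_mono intro: le_less_trans)
  qed
  then have "Lim (at_right 0) g = s" by (intro tendsto_Lim) simp_all
  moreover have "s = 0 \<longleftrightarrow> (\<forall>a>0. g a = 0)" by (auto simp: s_def simp flip: bot_ennreal)
  ultimately show ?thesis by simp
qed

text \<open>\<open>Lim\<close> is determined by the convergence relation, so eventual equality
  suffices even without knowing that a limit exists.\<close>

lemma Lim_at_right_0_cong:
  assumes "\<And>\<epsilon>::real. 0 < \<epsilon> \<Longrightarrow> \<epsilon> < 1 \<Longrightarrow> f \<epsilon> = g \<epsilon>"
  shows "Lim (at_right 0) f = Lim (at_right 0) g"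
proof -
  have "\<forall>\<^sub>F \<epsilon> in at_right 0. f \<epsilon> = g \<epsilon>"
    using eventually_at_right_real[OF zero_less_one] by (rule eventually_mono) (use assms in auto)
  then have "(f \<longlongrightarrow> l) (at_right 0) \<longleftrightarrow> (g \<longlongrightarrow> l) (at_right 0)" for l by (rule tendsto_cong)
  then show ?thesis by (simp add: Topological_Spaces.Lim_def)
qed

lemma hausdorff_measure_eq_0_iff:
  "hausdorff_measure X d s E = 0 \<longleftrightarrow> (\<forall>\<delta>>0. hausdorff_premeasure X d s \<delta> E = 0)"
  unfolding hausdorff_measure_def
proof (rule Lim_at_right_0_antimono_eq_0_iff)
  fix a b :: real assume "0 < a" "a \<le> b"
  then show "hausdorff_premeasure X d s b E \<le> hausdorff_premeasure X d s a E"
    unfolding hausdorff_premeasure_def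
    by (intro INF_superset_mono) (auto intro: order_trans ennreal_leI)
qed

context gluing_shift
begin

section \<open>Pressure and BS-dimension at a fixed scale\<close>

lemma pressure_C_eq_0_iff:
  "pressure_C X d shift E t \<phi> \<epsilon> = 0 \<longleftrightarrow> (\<forall>n. cover_inf X d shift E \<epsilon>
    (\<lambda>x m. 2 powr (- t * real m + (SUP y\<in>bowen_ball X d shift m x \<epsilon>. S \<phi> m y))) n = 0)"
  unfolding pressure_C_def pressure_C_n_def cover_inf_def[symmetric]
  by (rule lim_cover_inf_eq_0_iff)

lemma BS_N_eq_0_iff:
  "BS_N X d shift E t \<phi> \<epsilon> = 0 \<longleftrightarrow> (\<forall>n. cover_inf X d shift E \<epsilon>
    (\<lambda>x m. 2 powr (- t * (SUP y\<in>bowen_ball X d shift m x \<epsilon>. S \<phi> m y))) n = 0)"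
  unfolding BS_N_def BS_N_n_def cover_inf_def[symmetric]
  by (rule lim_cover_inf_eq_0_iff)

lemma CI_subset: "CI \<subseteq> X"
  by (simp add: completely_irregular_set_def)

lemma cover_inf_CI_eq_0: "cover_inf X d shift X \<epsilon> w n = 0 \<Longrightarrow> cover_inf X d shift CI \<epsilon> w n = 0"
  using cover_inf_mono[of n n CI X X d shift \<epsilon> w, OF order_refl CI_subset] by simp

text \<open>Raising \<open>t\<close> by \<delta> gains \<open>\<delta> * m\<close> in the exponent:
  one half pays for the number of new balls, the other for the change of the suprema.\<close>

lemma pressure_at_scale_CI:
  assumes \<phi>: "\<phi> \<in> C0 X d" and \<epsilon>: "0 < \<epsilon>" "\<epsilon> < 1"
  shows "pressure_at_scale X d shift CI \<phi> \<epsilon> = pressure_at_scale X d shift X \<phi> \<epsilon>"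
  unfolding pressure_at_scale_def
proof (rule Inf_ereal_eqI)
  show "{t. pressure_C X d shift X t \<phi> \<epsilon> = 0} \<subseteq> {t. pressure_C X d shift CI t \<phi> \<epsilon> = 0}"
    by (auto simp: pressure_C_eq_0_iff intro: cover_inf_CI_eq_0)
next
  fix t \<delta> :: real assume t: "t \<in> {t. pressure_C X d shift CI t \<phi> \<epsilon> = 0}" and \<delta>: "\<delta> > 0"
  obtain r where sc: "scale \<epsilon> r" using scale_ex[OF \<epsilon>] .
  have \<delta>2: "\<delta> / 2 > 0" using \<delta> by simp
  obtain \<alpha> :: real and N where \<alpha>: "\<alpha> > 0" and le: "\<And>x z m. m \<ge> N \<Longrightarrow> x \<in> X \<Longrightarrow> z \<in> X \<Longrightarrow> real (mism x z m) \<le> \<alpha> * m \<Longrightarrow>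
    (SUP y\<in>bowen_ball X d shift m z \<epsilon>. S \<phi> m y) \<le> (SUP y\<in>bowen_ball X d shift m x \<epsilon>. S \<phi> m y) + \<delta> / 2 * m"
    using SUP_birkhoff_le[OF C0_tame[OF \<phi>] sc \<delta>2] by blast
  show "t + \<delta> \<in> {t. pressure_C X d shift X t \<phi> \<epsilon> = 0}"
    unfolding mem_Collect_eq pressure_C_eq_0_iff
  proof (intro allI cover_inf_transfer[OF sc \<delta>2 \<alpha>])
    fix x z m assume "m \<ge> N" "x \<in> X" "z \<in> X" "real (mism x z m) \<le> \<alpha> * m"
    from le[OF this]
    show "2 powr (- (t + \<delta>) * real m + (SUP y\<in>bowen_ball X d shift m z \<epsilon>. S \<phi> m y)) * 2 powr (\<delta> / 2 * m)
      \<le> 2 powr (- t * real m + (SUP y\<in>bowen_ball X d shift m x \<epsilon>. S \<phi> m y))"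
      unfolding powr_add[symmetric] by (intro powr_mono) (simp_all add: algebra_simps)
  next
    show "cover_inf X d shift CI \<epsilon> (\<lambda>x m. 2 powr (- t * real m + (SUP y\<in>bowen_ball X d shift m x \<epsilon>. S \<phi> m y))) n = 0" for n
      using t by (simp add: pressure_C_eq_0_iff)
  qed simp
qed

text \<open>Positivity makes the suprema grow at least like \<open>c * m\<close>, so raising
  \<open>t\<close> by \<delta> gains at least \<open>\<delta> * c * m\<close>. Half of this pays for
  the number of new balls and half for the change of the suprema.\<close>

lemma BS_dimension_at_scale_CI:
  assumes \<phi>: "\<phi> \<in> C0 X d" and pos: "\<And>x. x \<in> X \<Longrightarrow> \<phi> x > 0" and \<epsilon>: "0 < \<epsilon>" "\<epsilon> < 1"
  shows "BS_dimension_at_scale X d shift CI \<phi> \<epsilon> = BS_dimension_at_scale X d shift X \<phi> \<epsilon>"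
  unfolding BS_dimension_at_scale_def
proof (rule Inf_ereal_eqI)
  show "{t. BS_N X d shift X t \<phi> \<epsilon> = 0} \<subseteq> {t. BS_N X d shift CI t \<phi> \<epsilon> = 0}"
    by (auto simp: BS_N_eq_0_iff intro: cover_inf_CI_eq_0)
next
  fix t \<delta> :: real assume t: "t \<in> {t. BS_N X d shift CI t \<phi> \<epsilon> = 0}" and \<delta>: "\<delta> > 0"
  obtain r where sc: "scale \<epsilon> r" using scale_ex[OF \<epsilon>] .
  obtain c where c: "c > 0" "\<And>x. x \<in> X \<Longrightarrow> \<phi> x \<ge> c" using C0_pos_lower_bound[OF \<phi> pos] by blast
  obtain B where B: "\<And>x. x \<in> X \<Longrightarrow> \<bar>\<phi> x\<bar> \<le> B" using tame_bounded[OF C0_tame[OF \<phi>]] by metis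
  define G where "G x m = (SUP y\<in>bowen_ball X d shift m x \<epsilon>. S \<phi> m y)" for x m
  have G: "c * m \<le> G x m" if "x \<in> X" for x m
  proof -
    have "c * m = (\<Sum>i<m. c)" by simp
    also have "\<dots> \<le> S \<phi> m x"
      unfolding birkhoff_sum_def using that by (intro sum_mono c shift_pow_mem)
    also have "\<dots> \<le> G x m"
      unfolding G_def
    proof (rule cSUP_upper)
      show "bdd_above (S \<phi> m ` bowen_ball X d shift m x \<epsilon>)"
        using birkhoff_bound[of \<phi> B _ m] B bowen_ball_subset
        by (intro bdd_aboveI2[where M = "B * m"]) (meson abs_le_D1 subsetD)
    qed (rule bowen_ball_self[OF sc that])
    finally show ?thesis .
  qed
  \<comment> \<open>The variation of the suprema is multiplied by \<open>t\<close>;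
    \<open>\<bar>t\<bar> + 1\<close> keeps the denominator positive when
    \<open>t = 0\<close>.\<close>
  define \<kappa> where "\<kappa> = \<delta> * c / (2 * (\<bar>t\<bar> + 1))"
  have \<kappa>: "\<kappa> > 0" using \<delta> c by (simp add: \<kappa>_def add_nonneg_pos)
  have t\<kappa>: "\<bar>t\<bar> * \<kappa> \<le> \<delta> * c / 2"
  proof -
    have "(\<bar>t\<bar> + 1) * \<kappa> = \<delta> * c / 2" by (simp add: \<kappa>_def field_simps)
    then show ?thesis using \<kappa> by (simp add: algebra_simps)
  qed
  obtain \<alpha> :: real and N where \<alpha>: "\<alpha> > 0" and le: "\<And>x z m. m \<ge> N \<Longrightarrow> x \<in> X \<Longrightarrow> z \<in> X \<Longrightarrow> real (mism x z m) \<le> \<alpha> * m \<Longrightarrow>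
    G z m \<le> G x m + \<kappa> * m"
    using SUP_birkhoff_le[OF C0_tame[OF \<phi>] sc \<kappa>] unfolding G_def by blast
  have \<delta>2: "\<delta> * c / 2 > 0" using \<delta> c by simp
  show "t + \<delta> \<in> {t. BS_N X d shift X t \<phi> \<epsilon> = 0}"
    unfolding mem_Collect_eq BS_N_eq_0_iff G_def[symmetric]
  proof (intro allI cover_inf_transfer[OF sc \<delta>2 \<alpha>])
    fix x z m assume *: "m \<ge> N" "x \<in> X" "z \<in> X" "real (mism x z m) \<le> \<alpha> * m"
    \<comment> \<open>Since \<open>t\<close> may have either sign, a two-sided bound is required;
      the other side comes from exchanging \<open>x\<close> and \<open>z\<close>.\<close>
    have "\<bar>G z m - G x m\<bar> \<le> \<kappa> * m"
      using le[OF *] le[of m z x] * mism_commute[of x z m] by (simp add: abs_le_iff)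
    then have "\<bar>t\<bar> * \<bar>G z m - G x m\<bar> \<le> \<bar>t\<bar> * (\<kappa> * m)" by (intro mult_left_mono) auto
    then have "\<bar>t * (G z m - G x m)\<bar> \<le> \<bar>t\<bar> * \<kappa> * m" by (simp add: abs_mult mult.assoc)
    also have "\<dots> \<le> \<delta> * c / 2 * m" using t\<kappa> by (intro mult_right_mono) auto
    finally have "t * G x m - t * G z m \<le> \<delta> * c / 2 * m"
      unfolding right_diff_distrib abs_le_iff by linarith
    moreover have "\<delta> * (c * m) \<le> \<delta> * G z m" using \<delta> G *(3) by (intro mult_left_mono) auto
    ultimately have "- (t + \<delta>) * G z m + \<delta> * c / 2 * m \<le> - t * G x m" by (simp add: algebra_simps)
    then show "2 powr (- (t + \<delta>) * G z m) * 2 powr (\<delta> * c / 2 * m) \<le> 2 powr (- t * G x m)"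
      unfolding powr_add[symmetric] by (intro powr_mono) simp_all
  next
    show "cover_inf X d shift CI \<epsilon> (\<lambda>x m. 2 powr (- t * G x m)) n = 0" for n
      using t by (simp add: BS_N_eq_0_iff G_def)
  qed simp
qed

section \<open>Hausdorff measure through covers by cylinders\<close>

lemma bowen_ball_inverse: "bowen_ball X d shift m x (1 / \<beta>) = {y \<in> X. \<forall>i<m. x i = y i}"
proof (cases "m = 0")
  case True
  then show ?thesis by (simp add: bowen_ball_def)
next
  case False
  then show ?thesis using bowen_ball_eq[OF scale_inverse, of m] by simp
qed

lemma inverse_power_powr: "(1 / \<beta> ^ m) powr s = \<beta> powr (- s * real m)"
proof -
  have "1 / \<beta> ^ m = \<beta> powr (- real m)"
    using beta_gt_1 by (simp add: powr_minus_divide powr_realpow)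
  then show ?thesis by (simp add: powr_powr mult.commute)
qed

text \<open>A set with two points has diameter at least \<open>1 / \<beta> ^ m\<close> for the first
  index \<open>m\<close> where its points disagree, and lies in a cylinder of length
  \<open>m\<close>, so nothing is lost. A one-point set has diameter 0 and needs a long cylinder,
  whose weight is paid by \<open>e\<close>.\<close>

lemma ball_cover_of_set:
  assumes U: "U \<subseteq> X" "U \<noteq> {}" and small: "ediam d U \<le> ennreal (1 / \<beta> ^ n)"
    and s: "s > 0" and e: "e > 0"
  shows "\<exists>c. fst c \<in> X \<and> snd c \<ge> n \<and> U \<subseteq> bowen_ball X d shift (snd c) (fst c) (1 / \<beta>) \<and>
    \<beta> powr (- s * real (snd c)) \<le> enn2real (ediam d U) powr s + e"
proof -
  obtain x where x: "x \<in> U" using U(2) by blast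
  have upper: "ennreal (d x y) \<le> ediam d U" if "x \<in> U" "y \<in> U" for x y
    unfolding ediam_def using that by (meson SUP_upper SUP_upper2)
  show ?thesis
  proof (cases "U = {x}")
    case True
    have "(\<lambda>m. (\<beta> powr (- s)) ^ m) \<longlonglongrightarrow> 0"
      using beta_gt_1 s by (intro LIMSEQ_realpow_zero) (auto simp: powr_less_one)
    then have "\<forall>\<^sub>F m in sequentially. (\<beta> powr (- s)) ^ m < e \<and> m \<ge> n"
      using e by (intro eventually_conj order_tendstoD(2) eventually_ge_at_top)
    from eventually_happens'[OF sequentially_bot this]
    obtain m where m: "(\<beta> powr (- s)) ^ m < e" "m \<ge> n" by blast
    have "\<beta> powr (- s * real m) = (\<beta> powr (- s)) ^ m"
      using beta_gt_1 by (simp add: powr_power mult.commute)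
    then show ?thesis
      using m True x U(1)
      by (intro exI[of _ "(x, m)"]) (auto simp: bowen_ball_inverse intro: add_increasing)
  next
    case False
    then obtain y where y: "y \<in> U" "y \<noteq> x" using x by blast
    then obtain i where "x i \<noteq> y i" by fastforce
    define P where "P i \<longleftrightarrow> (\<exists>x\<in>U. \<exists>y\<in>U. x i \<noteq> y i)" for i
    define m where "m = (LEAST i. P i)"
    have "P i" using x y(1) \<open>x i \<noteq> y i\<close> by (auto simp: P_def)
    then have "P m" unfolding m_def by (rule LeastI)
    then obtain u v where uv: "u \<in> U" "v \<in> U" "u m \<noteq> v m" by (auto simp: P_def)
    have agree: "u i = v i" if "u \<in> U" "v \<in> U" "i < m" for u v i
      using not_less_Least[of i P] that unfolding m_def P_def by blast
    have "ennreal (d u v) \<le> ennreal (1 / \<beta> ^ n)" using upper[OF uv(1,2)] small by (rule order_trans)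
    then have "d u v \<le> 1 / \<beta> ^ n" using beta_gt_1 by (simp add: ennreal_le_iff)
    then have "\<forall>i<n. u i = v i" using beta_dist_le_power[OF beta_gt_1] by blast
    then have mn: "m \<ge> n" using uv(3) by (meson not_le)
    have fin: "ediam d U < top" using small by (rule le_less_trans) simp
    have "1 / \<beta> ^ m \<le> d u v" using beta_gt_1 uv(3) by (rule beta_dist_ge)
    then have "ennreal (1 / \<beta> ^ m) \<le> ediam d U" using upper[OF uv(1,2)] by (meson ennreal_leI order_trans)
    then have "enn2real (ennreal (1 / \<beta> ^ m)) \<le> enn2real (ediam d U)" using fin by (rule enn2real_mono)
    then have diam: "1 / \<beta> ^ m \<le> enn2real (ediam d U)" using beta_gt_1 by simp
    have "\<beta> powr (- s * real m) = (1 / \<beta> ^ m) powr s"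
      by (simp only: inverse_power_powr)
    also have "\<dots> \<le> enn2real (ediam d U) powr s"
      using diam beta_gt_1 s by (intro powr_mono2) auto
    finally have "\<beta> powr (- s * real m) \<le> enn2real (ediam d U) powr s + e" using e by simp
    moreover have "U \<subseteq> bowen_ball X d shift m x (1 / \<beta>)"
      using agree x U(1) by (auto simp: bowen_ball_inverse)
    ultimately show ?thesis
      using mn x U(1) by (intro exI[of _ "(x, m)"]) auto
  qed
qed

lemma cover_inf_eq_0_of_hausdorff:
  assumes s: "s > 0" and E: "hausdorff_measure X d s E = 0"
  shows "cover_inf X d shift E (1 / \<beta>) (\<lambda>x m. \<beta> powr (- s * real m)) n = 0"
proof -
  have "cover_inf X d shift E (1 / \<beta>) (\<lambda>x m. \<beta> powr (- s * real m)) n \<le> 0 + ennreal e" if e: "e > 0" for e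
  proof -
    have "1 / \<beta> ^ n > 0" using beta_gt_1 by simp
    then have "hausdorff_premeasure X d s (1 / \<beta> ^ n) E = 0"
      using E unfolding hausdorff_measure_eq_0_iff by blast
    then have "hausdorff_premeasure X d s (1 / \<beta> ^ n) E < ennreal (e / 2)" using e by simp
    from this[unfolded hausdorff_premeasure_def INF_less_iff]
    obtain \<U> where U0: "\<U> \<in> {\<U>. countable \<U> \<and> \<U> \<subseteq> Pow X \<and>
        (\<forall>U\<in>\<U>. ediam d U \<le> ennreal (1 / \<beta> ^ n)) \<and> E \<subseteq> \<Union>\<U>}"
      and sum: "(\<Sum>\<^sub>\<infinity>U\<in>\<U>. ennreal (enn2real (ediam d U) powr s)) < ennreal (e / 2)"
      by (rule bexE)
    then have U: "countable \<U>" "\<U> \<subseteq> Pow X" "\<forall>U\<in>\<U>. ediam d U \<le> ennreal (1 / \<beta> ^ n)" "E \<subseteq> \<Union>\<U>"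
      by simp_all
    \<comment> \<open>The empty set offers no centre for a ball.\<close>
    define \<V> where "\<V> = \<U> - {{}}"
    have cV: "countable \<V>" using U(1) by (simp add: \<V>_def)
    \<comment> \<open>Geometric weights along an enumeration keep the sum of all errors at most
      \<open>e / 2\<close>.\<close>
    define h where "h U = e / 2 * (1 / 2) ^ Suc (to_nat_on \<V> U)" for U
    have h: "h U > 0" for U using e by (simp add: h_def)
    have "\<forall>U\<in>\<V>. \<exists>c. fst c \<in> X \<and> snd c \<ge> n \<and> U \<subseteq> bowen_ball X d shift (snd c) (fst c) (1 / \<beta>) \<and>
      \<beta> powr (- s * real (snd c)) \<le> enn2real (ediam d U) powr s + h U"
      using U(2,3) by (intro ballI ball_cover_of_set s h) (auto simp: \<V>_def)
    then obtain c where c: "\<And>U. U \<in> \<V> \<Longrightarrow> fst (c U) \<in> X \<and> snd (c U) \<ge> n \<and>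
      U \<subseteq> bowen_ball X d shift (snd (c U)) (fst (c U)) (1 / \<beta>) \<and>
      \<beta> powr (- s * real (snd (c U))) \<le> enn2real (ediam d U) powr s + h U"
      unfolding bchoice_iff by blast
    define \<C> where "\<C> = (\<Union>U\<in>\<V>. {c U})"
    have "\<C> \<in> bowen_covers X d shift n E (1 / \<beta>)"
      unfolding bowen_covers_def
    proof (intro CollectI conjI)
      show "countable \<C>" using cV by (simp add: \<C>_def)
      have "c U \<in> X \<times> {n..}" if "U \<in> \<V>" for U using c[OF that] by (simp add: mem_Times_iff)
      then show "\<C> \<subseteq> X \<times> {n..}" unfolding \<C>_def by blast
      show "E \<subseteq> (\<Union>(x, m)\<in>\<C>. bowen_ball X d shift m x (1 / \<beta>))"
      proof
        fix x assume "x \<in> E"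
        then obtain U where "x \<in> U" "U \<in> \<V>" using U(4) by (auto simp: \<V>_def)
        then have "x \<in> bowen_ball X d shift (snd (c U)) (fst (c U)) (1 / \<beta>)" "c U \<in> \<C>"
          using c by (auto simp: \<C>_def)
        then show "x \<in> (\<Union>(x, m)\<in>\<C>. bowen_ball X d shift m x (1 / \<beta>))"
          by (auto simp: case_prod_beta)
      qed
    qed
    then have "cover_inf X d shift E (1 / \<beta>) (\<lambda>x m. \<beta> powr (- s * real m)) n
        \<le> (\<Sum>\<^sub>\<infinity>(x, m)\<in>\<C>. ennreal (\<beta> powr (- s * real m)))"
      unfolding cover_inf_def by (rule INF_lower)
    also have "\<dots> \<le> (\<Sum>\<^sub>\<infinity>U\<in>\<V>. ennreal (enn2real (ediam d U) powr s) + ennreal (h U))"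
      unfolding \<C>_def
    proof (rule infsum_UNION_le_ennreal)
      fix U assume "U \<in> \<V>"
      then have "ennreal (\<beta> powr (- s * real (snd (c U)))) \<le> ennreal (enn2real (ediam d U) powr s + h U)"
        using c by (intro ennreal_leI) blast
      then show "(\<Sum>(x, m)\<in>{c U}. ennreal (\<beta> powr (- s * real m))) \<le> ennreal (enn2real (ediam d U) powr s) + ennreal (h U)"
        using h[of U] by (simp add: case_prod_beta)
    qed simp
    also have "\<dots> = (\<Sum>\<^sub>\<infinity>U\<in>\<V>. ennreal (enn2real (ediam d U) powr s)) + (\<Sum>\<^sub>\<infinity>U\<in>\<V>. ennreal (h U))"
      by (intro infsum_add ennreal_summable_on)
    also have "\<dots> \<le> ennreal (e / 2) + ennreal (e / 2)"
    proof (rule add_mono)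
      have "(\<Sum>\<^sub>\<infinity>U\<in>\<V>. ennreal (enn2real (ediam d U) powr s)) \<le> (\<Sum>\<^sub>\<infinity>U\<in>\<U>. ennreal (enn2real (ediam d U) powr s))"
        by (rule infsum_mono_neutral) (auto simp: ennreal_summable_on \<V>_def)
      then show "(\<Sum>\<^sub>\<infinity>U\<in>\<V>. ennreal (enn2real (ediam d U) powr s)) \<le> ennreal (e / 2)"
        using sum by simp
      show "(\<Sum>\<^sub>\<infinity>U\<in>\<V>. ennreal (h U)) \<le> ennreal (e / 2)"
      proof (rule infsum_le_finite_sums[OF ennreal_summable_on])
        fix T assume T: "finite T" "T \<subseteq> \<V>"
        have inj: "inj_on (to_nat_on \<V>) T" using inj_on_to_nat_on[OF cV] T(2) by (rule inj_on_subset)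
        have "(\<Sum>U\<in>T. h U) = e / 2 * (\<Sum>i\<in>to_nat_on \<V> ` T. (1 / 2) ^ Suc i)"
          by (simp add: h_def sum_distrib_left sum.reindex[OF inj])
        also have "\<dots> \<le> e / 2 * 1" using T e by (intro mult_left_mono sum_half_powers_le) auto
        finally have "ennreal (\<Sum>U\<in>T. h U) \<le> ennreal (e / 2)" by (intro ennreal_leI) simp
        then show "(\<Sum>U\<in>T. ennreal (h U)) \<le> ennreal (e / 2)"
          using h by (simp add: sum_ennreal less_imp_le)
      qed
    qed
    also have "\<dots> = 0 + ennreal e" using e by (simp flip: ennreal_plus)
    finally show ?thesis .
  qed
  then have "cover_inf X d shift E (1 / \<beta>) (\<lambda>x m. \<beta> powr (- s * real m)) n \<le> 0"
    by (rule ennreal_le_epsilon)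
  then show ?thesis by simp
qed

text \<open>Balls of length at least \<open>n\<close> have diameter at most
  \<open>1 / \<beta> ^ n\<close>, so a cover by long balls is admissible for the premeasure.\<close>

lemma hausdorff_eq_0_of_cover_inf:
  assumes s: "s > 0"
    and zero: "\<And>n. cover_inf X d shift E (1 / \<beta>) (\<lambda>x m. \<beta> powr (- s * real m)) n = 0"
  shows "hausdorff_measure X d s E = 0"
  unfolding hausdorff_measure_eq_0_iff
proof (intro allI impI)
  fix \<delta> :: real assume \<delta>: "\<delta> > 0"
  obtain n where "(1 / \<beta>) ^ n < \<delta>"
    using real_arch_pow_inv[OF \<delta>, of "1 / \<beta>"] beta_gt_1 by auto
  then have n: "1 / \<beta> ^ n < \<delta>" by (simp add: power_one_over)
  have diam: "ediam d (bowen_ball X d shift m x (1 / \<beta>)) \<le> ennreal (1 / \<beta> ^ m)" for m x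
    unfolding ediam_def bowen_ball_inverse
    using beta_dist_le_power[OF beta_gt_1] by (intro SUP_least ennreal_leI) auto
  have "hausdorff_premeasure X d s \<delta> E \<le> cover_inf X d shift E (1 / \<beta>) (\<lambda>x m. \<beta> powr (- s * real m)) n"
    unfolding cover_inf_def
  proof (rule INF_greatest)
    fix \<C> assume \<C>: "\<C> \<in> bowen_covers X d shift n E (1 / \<beta>)"
    define b where "b c = (case c of (x, m) \<Rightarrow> bowen_ball X d shift m x (1 / \<beta>))" for c
    define \<U> where "\<U> = (\<Union>c\<in>\<C>. {b c})"
    have "ediam d (b c) \<le> ennreal \<delta>" if "c \<in> \<C>" for c
    proof -
      obtain x m where c: "c = (x, m)" by (cases c)
      then have "m \<ge> n" using \<C> that by (auto simp: bowen_covers_def)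
      then have "1 / \<beta> ^ m \<le> 1 / \<beta> ^ n"
        using beta_gt_1 by (intro divide_left_mono power_increasing) auto
      then have "1 / \<beta> ^ m \<le> \<delta>" using n by simp
      then show ?thesis using diam[of m x] by (auto simp: b_def c intro: order_trans ennreal_leI)
    qed
    then have "\<U> \<in> {\<U>. countable \<U> \<and> \<U> \<subseteq> Pow X \<and> (\<forall>U\<in>\<U>. ediam d U \<le> ennreal \<delta>) \<and> E \<subseteq> \<Union>\<U>}"
      using \<C> bowen_ball_subset by (auto simp: bowen_covers_def \<U>_def b_def; fastforce)
    then have "hausdorff_premeasure X d s \<delta> E \<le> (\<Sum>\<^sub>\<infinity>U\<in>\<U>. ennreal (enn2real (ediam d U) powr s))"
      unfolding hausdorff_premeasure_def by (rule INF_lower)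
    also have "\<dots> \<le> (\<Sum>\<^sub>\<infinity>(x, m)\<in>\<C>. ennreal (\<beta> powr (- s * real m)))"
      unfolding \<U>_def
    proof (rule infsum_UNION_le_ennreal)
      fix c assume "c \<in> \<C>"
      obtain x m where c: "c = (x, m)" by (cases c)
      have "enn2real (ediam d (b c)) \<le> 1 / \<beta> ^ m"
        using diam[of m x] beta_gt_1 by (intro enn2real_leI) (auto simp: b_def c)
      then have "enn2real (ediam d (b c)) powr s \<le> (1 / \<beta> ^ m) powr s"
        using s by (intro powr_mono2) auto
      also have "\<dots> = \<beta> powr (- s * real m)"
        by (simp only: inverse_power_powr)
      finally show "(\<Sum>U\<in>{b c}. ennreal (enn2real (ediam d U) powr s)) \<le> (case c of (x, m) \<Rightarrow> ennreal (\<beta> powr (- s * real m)))"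
        by (simp add: c ennreal_leI)
    qed simp
    finally show "hausdorff_premeasure X d s \<delta> E \<le> (\<Sum>\<^sub>\<infinity>(x, m)\<in>\<C>. ennreal (\<beta> powr (- s * real m)))" .
  qed
  then show "hausdorff_premeasure X d s \<delta> E = 0" using zero by simp
qed

lemma hausdorff_dim_CI: "hausdorff_dim X d CI = hausdorff_dim X d X"
  unfolding hausdorff_dim_def
proof (rule Inf_ereal_eqI)
  show "{s. s > 0 \<and> hausdorff_measure X d s X = 0} \<subseteq> {s. s > 0 \<and> hausdorff_measure X d s CI = 0}"
    by (auto intro!: hausdorff_eq_0_of_cover_inf cover_inf_CI_eq_0 cover_inf_eq_0_of_hausdorff)
next
  fix s \<delta> :: real assume s: "s \<in> {s. s > 0 \<and> hausdorff_measure X d s CI = 0}" and \<delta>: "\<delta> > 0"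
  \<comment> \<open>Chosen so that
    \<open>2 powr (\<delta>' * m) = \<beta> powr (\<delta> * m)\<close>. The weights depend on
    \<open>m\<close> alone, so any positive mismatch proportion serves; 1 is taken.\<close>
  define \<delta>' where "\<delta>' = \<delta> * log 2 \<beta>"
  have \<delta>': "\<delta>' > 0" using \<delta> beta_gt_1 by (simp add: \<delta>'_def)
  have "cover_inf X d shift X (1 / \<beta>) (\<lambda>x m. \<beta> powr (- (s + \<delta>) * real m)) n = 0" for n
  proof (rule cover_inf_transfer[OF scale_inverse \<delta>' zero_less_one])
    fix m :: nat
    have "2 powr (\<delta>' * real m) = (2 powr log 2 \<beta>) powr (\<delta> * real m)"
      by (simp only: powr_powr \<delta>'_def mult_ac)
    then have "2 powr (\<delta>' * real m) = \<beta> powr (\<delta> * real m)" using beta_gt_1 by simp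
    then show "\<beta> powr (- (s + \<delta>) * real m) * 2 powr (\<delta>' * m) \<le> \<beta> powr (- s * real m)"
      by (simp add: powr_add[symmetric] algebra_simps)
  next
    show "cover_inf X d shift CI (1 / \<beta>) (\<lambda>x m. \<beta> powr (- s * real m)) n = 0" for n
      using s by (intro cover_inf_eq_0_of_hausdorff) auto
  qed simp
  then show "s + \<delta> \<in> {s. s > 0 \<and> hausdorff_measure X d s X = 0}"
    using s \<delta> by (auto intro: hausdorff_eq_0_of_cover_inf)
qed

end

theorem theorem1p12:
  fixes \<beta> :: real
  assumes "\<beta> > 1"
  shows
    "let X = beta_shift \<beta>; d = beta_dist \<beta>; CI = completely_irregular_set X d shift in
       topological_entropy X d shift CI = topological_entropy X d shift X \<and>
       (\<forall>\<phi>\<in>C0 X d. topological_pressure X d shift CI \<phi> = topological_pressure X d shift X \<phi>) \<and>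
       (\<forall>\<phi>\<in>C0 X d. (\<forall>x\<in>X. \<phi> x > 0) \<longrightarrow>
          BS_dimension X d shift CI \<phi> = BS_dimension X d shift X \<phi>) \<and>
       hausdorff_dim X d CI = hausdorff_dim X d X"
proof -
  obtain k where k: "beta_shift \<beta> \<subseteq> UNIV \<rightarrow> {..<k}" "gluing (beta_shift \<beta>)" "closed_shift (beta_shift \<beta>)"
    using beta_shift_structure[OF assms] by blast
  interpret gluing_shift "beta_shift \<beta>" k \<beta>
    by (rule gluing_shift.intro[OF assms k(1) shift_in_beta_shift k(3,2) Metric_space_beta_dist[OF assms]])
  have pressure: "topological_pressure (beta_shift \<beta>) d shift CI \<phi> = topological_pressure (beta_shift \<beta>) d shift (beta_shift \<beta>) \<phi>"
    if "\<phi> \<in> C0 (beta_shift \<beta>) d" for \<phi>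
    unfolding topological_pressure_def by (intro Lim_at_right_0_cong pressure_at_scale_CI that)
  moreover have "(\<lambda>_. 0) \<in> C0 (beta_shift \<beta>) d" by (simp add: C0_def)
  moreover have "BS_dimension (beta_shift \<beta>) d shift CI \<phi> = BS_dimension (beta_shift \<beta>) d shift (beta_shift \<beta>) \<phi>"
    if "\<phi> \<in> C0 (beta_shift \<beta>) d" "\<forall>x\<in>beta_shift \<beta>. \<phi> x > 0" for \<phi>
    unfolding BS_dimension_def using that by (intro Lim_at_right_0_cong BS_dimension_at_scale_CI) auto
  ultimately show ?thesis
    unfolding Let_def topological_entropy_def using hausdorff_dim_CI by blast
qed

end
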